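(* There exists a countable $\beta$-model $M$ such that for every $X \in M$: if $X$ is definable in $M$, then $X \in \mathrm{HYP}$.
   Context: An $\omega$-model is a structure for the language of second order arithmetic whose first order part is the standard natural numbers $\omega$; it is identified with its collection $M \subseteq \mathcal{P}(\omega)$ of sets. A $\beta$-model is an $\omega$-model $M$ such that for every $\Sigma^1_1$ sentence $\varphi$ with parameters from $M$, $\varphi$ is true if and only if $M \models \varphi$. $\mathrm{HYP}$ denotes the set of hyperarithmetical subsets of $\omega$. A set $X \in M$ is definable in $M$ if there is a formula $\varphi(X)$ of second order arithmetic with $X$ as its only free variable (and no parameters) such that $M \models (\exists \text{ exactly one } X)\,\varphi(X)$ and $M\models\varphi(X)$ for this $X$. *)

theory Defs
  imports Main "HOL-Library.Countable_Set" "HOL-Library.Nat_Bijection"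
begin

text \<open>Number variables and set variables are two separate sorts, each indexed by \<^typ>\<open>nat\<close>.
  The remaining connectives and quantifiers are the usual classical abbreviations.\<close>

datatype trm = NVar nat | Zero | One | Plus trm trm | Times trm trm

datatype fm =
    Eq trm trm
  | Less trm trm
  | Mem trm nat
  | Neg fm
  | Conj fm fm
  | ExN nat fm
  | ExS nat fm

primrec trm_vars :: "trm \<Rightarrow> nat set" where
  "trm_vars (NVar i) = {i}"
| "trm_vars Zero = {}"
| "trm_vars One = {}"
| "trm_vars (Plus s t) = trm_vars s \<union> trm_vars t"
| "trm_vars (Times s t) = trm_vars s \<union> trm_vars t"

primrec free_num :: "fm \<Rightarrow> nat set" where
  "free_num (Eq s t) = trm_vars s \<union> trm_vars t"
| "free_num (Less s t) = trm_vars s \<union> trm_vars t"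
| "free_num (Mem t i) = trm_vars t"
| "free_num (Neg \<phi>) = free_num \<phi>"
| "free_num (Conj \<phi> \<psi>) = free_num \<phi> \<union> free_num \<psi>"
| "free_num (ExN i \<phi>) = free_num \<phi> - {i}"
| "free_num (ExS i \<phi>) = free_num \<phi>"

primrec free_set :: "fm \<Rightarrow> nat set" where
  "free_set (Eq s t) = {}"
| "free_set (Less s t) = {}"
| "free_set (Mem t i) = {i}"
| "free_set (Neg \<phi>) = free_set \<phi>"
| "free_set (Conj \<phi> \<psi>) = free_set \<phi> \<union> free_set \<psi>"
| "free_set (ExN i \<phi>) = free_set \<phi>"
| "free_set (ExS i \<phi>) = free_set \<phi> - {i}"

primrec trm_val :: "(nat \<Rightarrow> nat) \<Rightarrow> trm \<Rightarrow> nat" where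
  "trm_val e (NVar i) = e i"
| "trm_val e Zero = 0"
| "trm_val e One = 1"
| "trm_val e (Plus s t) = trm_val e s + trm_val e t"
| "trm_val e (Times s t) = trm_val e s * trm_val e t"

text \<open>\<open>sat M e E \<phi>\<close>: the \<open>\<omega>\<close>-model with set part \<open>M\<close> satisfies \<open>\<phi>\<close> under the assignments
  \<open>e\<close> of numbers and \<open>E\<close> of sets. With \<open>M = UNIV\<close> this is truth.\<close>

primrec sat :: "nat set set \<Rightarrow> (nat \<Rightarrow> nat) \<Rightarrow> (nat \<Rightarrow> nat set) \<Rightarrow> fm \<Rightarrow> bool" where
  "sat M e E (Eq s t) \<longleftrightarrow> trm_val e s = trm_val e t"
| "sat M e E (Less s t) \<longleftrightarrow> trm_val e s < trm_val e t"
| "sat M e E (Mem t i) \<longleftrightarrow> trm_val e t \<in> E i"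
| "sat M e E (Neg \<phi>) \<longleftrightarrow> \<not> sat M e E \<phi>"
| "sat M e E (Conj \<phi> \<psi>) \<longleftrightarrow> sat M e E \<phi> \<and> sat M e E \<psi>"
| "sat M e E (ExN i \<phi>) \<longleftrightarrow> (\<exists>n. sat M (e(i := n)) E \<phi>)"
| "sat M e E (ExS i \<phi>) \<longleftrightarrow> (\<exists>X\<in>M. sat M e (E(i := X)) \<phi>)"

primrec arithmetical :: "fm \<Rightarrow> bool" where
  "arithmetical (Eq s t) \<longleftrightarrow> True"
| "arithmetical (Less s t) \<longleftrightarrow> True"
| "arithmetical (Mem t i) \<longleftrightarrow> True"
| "arithmetical (Neg \<phi>) \<longleftrightarrow> arithmetical \<phi>"
| "arithmetical (Conj \<phi> \<psi>) \<longleftrightarrow> arithmetical \<phi> \<and> arithmetical \<psi>"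
| "arithmetical (ExN i \<phi>) \<longleftrightarrow> arithmetical \<phi>"
| "arithmetical (ExS i \<phi>) \<longleftrightarrow> False"

definition Sigma11 :: "fm \<Rightarrow> bool" where
  "Sigma11 \<phi> \<longleftrightarrow> (\<exists>i \<theta>. \<phi> = ExS i \<theta> \<and> arithmetical \<theta>)"

text \<open>A sentence with parameters from \<open>M\<close> is a formula together with an assignment of natural
  numbers and of elements of \<open>M\<close> to its free variables. The assignment \<open>E\<close> is constrained on the
  free set variables only, so the condition is not vacuous for \<open>M = {}\<close>; in particular
  every \<open>\<beta>\<close>-model is nonempty.\<close>

definition beta_model :: "nat set set \<Rightarrow> bool" where
  "beta_model M \<longleftrightarrow>
    (\<forall>\<phi> e E. Sigma11 \<phi> \<longrightarrow> (\<forall>i\<in>free_set \<phi>. E i \<in> M) \<longrightarrow>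
      (sat UNIV e E \<phi> \<longleftrightarrow> sat M e E \<phi>))"

text \<open>Since \<open>\<phi>\<close> has no free variable other than the set variable \<open>x\<close>, the constant assignments
  amount to evaluating \<open>\<phi>(Y)\<close>.\<close>

definition definable_in :: "nat set set \<Rightarrow> nat set \<Rightarrow> bool" where
  "definable_in M X \<longleftrightarrow> X \<in> M \<and>
    (\<exists>\<phi> x. free_num \<phi> = {} \<and> free_set \<phi> \<subseteq> {x} \<and>
      (\<exists>!Y. Y \<in> M \<and> sat M (\<lambda>_. 0) (\<lambda>_. Y) \<phi>) \<and>
      sat M (\<lambda>_. 0) (\<lambda>_. X) \<phi>)"

text \<open>Kleene's partial recursive functions relative to an oracle.\<close>

datatype recf =
    RZero
  | RSucc
  | RProj nat
  | RQuery
  | RComp recf "recf list"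
  | RPrim recf recf
  | RMin recf

text \<open>\<open>computes A f xs y\<close>: with oracle \<open>A\<close>, the function denoted by \<open>f\<close> is defined at the argument
  list \<open>xs\<close> and has value \<open>y\<close> there. The recursion variable and the search
  variable come first in the argument list.\<close>

inductive computes :: "nat set \<Rightarrow> recf \<Rightarrow> nat list \<Rightarrow> nat \<Rightarrow> bool" for A :: "nat set" where
  zero: "computes A RZero xs 0"
| succ: "computes A RSucc [n] (Suc n)"
| proj: "i < length xs \<Longrightarrow> computes A (RProj i) xs (xs ! i)"
| query: "computes A RQuery [n] (if n \<in> A then 1 else 0)"
| comp: "\<lbrakk>length ys = length gs; \<forall>i<length gs. computes A (gs ! i) xs (ys ! i);
    computes A f ys z\<rbrakk> \<Longrightarrow> computes A (RComp f gs) xs z"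
| prim_0: "computes A f xs z \<Longrightarrow> computes A (RPrim f g) (0 # xs) z"
| prim_Suc: "\<lbrakk>computes A (RPrim f g) (n # xs) y; computes A g (n # y # xs) z\<rbrakk>
    \<Longrightarrow> computes A (RPrim f g) (Suc n # xs) z"
| min: "\<lbrakk>computes A f (n # xs) 0; \<forall>m<n. \<exists>k. computes A f (m # xs) (Suc k)\<rbrakk>
    \<Longrightarrow> computes A (RMin f) xs n"

definition turing_le :: "nat set \<Rightarrow> nat set \<Rightarrow> bool" where
  "turing_le X A \<longleftrightarrow> (\<exists>f. \<forall>n. computes A f [n] (if n \<in> X then 1 else 0))"

definition recursive :: "nat set \<Rightarrow> bool" where
  "recursive X \<longleftrightarrow> turing_le X {}"

primrec code :: "recf \<Rightarrow> nat" where
  "code RZero = prod_encode (0, 0)"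
| "code RSucc = prod_encode (1, 0)"
| "code (RProj i) = prod_encode (2, i)"
| "code RQuery = prod_encode (3, 0)"
| "code (RComp f gs) = prod_encode (4, prod_encode (code f, list_encode (map code gs)))"
| "code (RPrim f g) = prod_encode (5, prod_encode (code f, code g))"
| "code (RMin f) = prod_encode (6, code f)"

definition turing_jump :: "nat set \<Rightarrow> nat set" where
  "turing_jump A = {prod_encode (code f, n) | f n. \<exists>y. computes A f [n] y}"

definition recursive_well_order :: "nat rel \<Rightarrow> bool" where
  "recursive_well_order r \<longleftrightarrow> Well_order r \<and> recursive (prod_encode ` r)"

text \<open>\<open>H\<close> iterates the Turing jump along \<open>r\<close> starting from the empty set: \<open>H a\<close> is the effective
  join of the jumps of all earlier \<open>H b\<close>. This determines \<open>H\<close> on the field of a well-ordering.\<close>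

definition jump_hierarchy :: "nat rel \<Rightarrow> (nat \<Rightarrow> nat set) \<Rightarrow> bool" where
  "jump_hierarchy r H \<longleftrightarrow>
    (\<forall>a\<in>Field r. H a = {prod_encode (b, m) | b m. (b, a) \<in> r \<and> b \<noteq> a \<and> m \<in> turing_jump (H b)})"

text \<open>A set is hyperarithmetical if it is recursive in some transfinite iterate of the Turing jump
  along a recursive well-ordering.\<close>

definition HYP :: "nat set set" where
  "HYP = {X. \<exists>r H a. recursive_well_order r \<and> jump_hierarchy r H \<and> a \<in> Field r \<and> turing_le X (H a)}"

end

theory Submission
  imports Defs "HOL-Library.Countable"
begin

text \<open>Force with nonempty effectively closed sets of functions \<open>F\<close> from numbers to numbers, each
  depending on finitely many rows of \<open>F\<close> only, and let \<open>M\<close> consist of the rows of a sufficiently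
  generic \<open>F\<close>. A \<open>\<Sigma>\<^sup>1\<^sub>1\<close> property of some rows can be turned into a closed one by placing witnesses in
  fresh rows, so genericity makes \<open>M\<close> a \<open>\<beta>\<close>-model. Suppose a condition \<open>p\<close> forces that row \<open>i\<close> is the
  only element of \<open>M\<close> with some property. Permuting rows preserves forcing; hence if row \<open>i\<close> took two
  values on \<open>p\<close>, then \<open>p\<close> could be combined with a disjoint copy of itself in which another row has
  the property and a different value. So row \<open>i\<close> is constant on \<open>p\<close>, and its value \<open>X\<close> is the constant
  row of an effectively closed set. Then \<open>m \<in> X\<close> is decided by a game on a recursive well-founded
  tree, which is solved by recursion along the Kleene--Brouwer order using one Turing jump per step.\<close>

subsection \<open>Oracle computations\<close>

text \<open>Conditions live in Baire space because every Sigma-1-1 property is a projection of a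
  closed set there: once its witness is stored in a row, the property is part of a condition, and
  closed sets do the work of Gandy's forcing with Sigma-1-1 sets. Compactness is lost, so a generic
  point has to be built by fixing its values one at a time. Finite support serves two purposes: it
  leaves room for witnesses, and room for a copy of a condition on disjoint rows.

  The last obstacle is that a constant row is at first only seen to be Delta-1-1: \<open>m\<close>
  belongs to it iff some point of the closed set has \<open>m\<close> in that row, and also iff no
  point lacks it. That such a set is in \<open>HYP\<close>, in the sense of jumps iterated along
  recursive well-orderings, is proved directly. The searches for the two kinds of points are
  interleaved in one tree, and winning at a position is expressed as halting of a single program
  that refers to its own code. The jump of an earlier level then answers exactly the question that
  the program asks about a later position of the play.\<close>

lemma computes_deterministic:
  "computes A f xs y \<Longrightarrow> computes A f xs z \<Longrightarrow> y = z"
proof (induction arbitrary: z rule: computes.induct)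
  case (comp ys gs xs f y)
  from comp.prems show ?case
  proof cases
    case (comp ys')
    have "ys = ys'"
      using comp.IH comp.hyps(1) comp(1,2) by (intro nth_equalityI) auto
    then show ?thesis using comp.IH comp(3) by blast
  qed
next
  case (prim_Suc f g n xs y z')
  from prim_Suc.prems show ?case by cases (use prim_Suc.IH in blast)
next
  case (min f n xs)
  from min.prems show ?case
  proof cases
    case min': min
    show ?thesis
    proof (rule linorder_cases[of n z])
      assume "n < z"
      then obtain k where "computes A f (n # xs) (Suc k)" using min' by blast
      then show ?thesis using min.IH by fastforce
    next
      assume "z < n"
      then show ?thesis using min.IH min'(1) by fastforce
    qed
  qed
next
  case (prim_0 f xs z' g)
  from prim_0.prems show ?case by cases (use prim_0.IH in blast)
qed (erule computes.cases; simp)+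

lemma code_inject: "code f = code g \<Longrightarrow> f = g"
proof (induction f arbitrary: g)
  case (RComp f gs)
  then obtain f' gs' where g: "g = RComp f' gs'" by (cases g) auto
  have "map code gs = map code gs'" using RComp.prems g by (simp add: list_encode_eq)
  then have "gs = gs'"
    using RComp.IH(2) by (intro nth_equalityI) (auto dest: map_eq_imp_length_eq simp: list_eq_iff_nth_eq)
  then show ?case using RComp g by auto
qed (case_tac g; force)+

abbreviation pair :: "nat \<Rightarrow> nat \<Rightarrow> nat" where "pair a b \<equiv> prod_encode (a, b)"
abbreviation p1 :: "nat \<Rightarrow> nat" where "p1 z \<equiv> fst (prod_decode z)"
abbreviation p2 :: "nat \<Rightarrow> nat" where "p2 z \<equiv> snd (prod_decode z)"

text \<open>One program has to serve every oracle, so the same closure rules cover ordinary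
  recursive functions and programs that query a level of a jump hierarchy.\<close>

definition orec :: "(nat set \<Rightarrow> nat \<Rightarrow> nat) \<Rightarrow> bool" where
  "orec F \<longleftrightarrow> (\<exists>r. \<forall>A n. computes A r [n] (F A n))"

definition odec :: "(nat set \<Rightarrow> nat \<Rightarrow> bool) \<Rightarrow> bool" where
  "odec P \<longleftrightarrow> orec (\<lambda>A x. if P A x then 1 else 0)"

abbreviation crec :: "(nat \<Rightarrow> nat) \<Rightarrow> bool" where "crec f \<equiv> orec (\<lambda>A. f)"

named_theorems orec_intros

lemma computes_comp1:
  "computes A g xs y \<Longrightarrow> computes A f [y] z \<Longrightarrow> computes A (RComp f [g]) xs z"
  by (rule computes.comp[of "[y]"]) auto

lemma computes_comp2:
  "computes A g xs y \<Longrightarrow> computes A h xs y' \<Longrightarrow> computes A f [y, y'] z \<Longrightarrow>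
    computes A (RComp f [g, h]) xs z"
  by (rule computes.comp[of "[y, y']"]) (auto simp: less_Suc_eq)

lemma computes_proj: "i < length xs \<Longrightarrow> y = xs ! i \<Longrightarrow> computes A (RProj i) xs y"
  using computes.proj by simp

section \<open>Programs for arithmetic and the Cantor pairing\<close>

definition "r_add = RPrim (RProj 0) (RComp RSucc [RProj 1])"

lemma r_add: "computes A r_add [a, b] (a + b)"
proof (induction a)
  case 0
  show ?case unfolding r_add_def by (rule prim_0) (simp add: computes_proj)
next
  case (Suc a)
  show ?case unfolding r_add_def
    by (rule prim_Suc[OF Suc[unfolded r_add_def]])
      (auto intro!: computes_comp1[where y = "a + b"] computes_proj computes.succ)
qed

definition "r_mult = RPrim RZero (RComp r_add [RProj 1, RProj 2])"

lemma r_mult: "computes A r_mult [a, b] (a * b)"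
proof (induction a)
  case 0
  show ?case unfolding r_mult_def by (rule prim_0) (simp add: computes.zero)
next
  case (Suc a)
  show ?case unfolding r_mult_def
    by (rule prim_Suc[OF Suc[unfolded r_mult_def]])
      (rule computes_comp2[where y = "a * b" and y' = b],
        auto intro!: computes_proj r_add[of A "a * b" b, simplified add.commute])
qed

definition "r_pred = RPrim RZero (RProj 0)"

lemma r_pred: "computes A r_pred [a] (a - 1)"
proof (induction a)
  case 0
  show ?case unfolding r_pred_def by (rule prim_0) (simp add: computes.zero)
next
  case (Suc a)
  show ?case unfolding r_pred_def
    by (rule prim_Suc[OF Suc[unfolded r_pred_def]]) (simp add: computes_proj)
qed

text \<open>Recursion runs on the first argument, so the subtrahend comes first: this is subtraction
  with its arguments swapped.\<close>

definition "r_bus = RPrim (RProj 0) (RComp r_pred [RProj 1])"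

lemma r_bus: "computes A r_bus [a, b] (b - a)"
proof (induction a)
  case 0
  show ?case unfolding r_bus_def by (rule prim_0) (simp add: computes_proj)
next
  case (Suc a)
  show ?case unfolding r_bus_def
    by (rule prim_Suc[OF Suc[unfolded r_bus_def]])
      (rule computes_comp1[where y = "b - a"],
        auto intro!: computes_proj r_pred[of A "b - a", simplified])
qed

definition "r_tri = RPrim RZero (RComp r_add [RComp RSucc [RProj 0], RProj 1])"

lemma r_tri: "computes A r_tri [a] (triangle a)"
proof (induction a)
  case 0
  show ?case unfolding r_tri_def by (rule prim_0) (simp add: computes.zero)
next
  case (Suc a)
  show ?case unfolding r_tri_def
    by (rule prim_Suc[OF Suc[unfolded r_tri_def]])
      (rule computes_comp2[where y = "Suc a" and y' = "triangle a"],
        auto intro!: computes_proj computes_comp1[where y = a] computes.succ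
          r_add[of A "Suc a" "triangle a", simplified add.commute[of "Suc a"], simplified])
qed

definition "r_pair = RComp r_add [RComp r_tri [r_add], RProj 0]"

lemma r_pair: "computes A r_pair [a, b] (pair a b)"
  unfolding r_pair_def prod_encode_def
  by (auto intro!: computes_comp2[where y = "triangle (a + b)" and y' = a] computes_proj
      computes_comp1[where y = "a + b"] r_add r_tri)

lemma triangle_mono: "a \<le> b \<Longrightarrow> triangle a \<le> triangle b"
  by (induction b) (auto simp: le_Suc_eq)

text \<open>Since \<open>pair a b = triangle (a + b) + a\<close>, the sum \<open>a + b\<close> is
  the least \<open>w\<close> with \<open>z < triangle (w + 1)\<close>. Both components of
  \<open>z\<close> then follow by subtraction.\<close>

definition "r_psum = RMin (RComp r_bus [RComp r_tri [RComp RSucc [RProj 0]], RComp RSucc [RProj 1]])"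

lemma r_psum: "computes A r_psum [pair a b] (a + b)"
proof -
  let ?r = "RComp r_bus [RComp r_tri [RComp RSucc [RProj 0]], RComp RSucc [RProj 1]]"
  have c: "computes A ?r [w, z] (Suc z - triangle (Suc w))" for w z
    by (rule computes_comp2[OF computes_comp1[OF computes_comp1[OF _ computes.succ] r_tri]
          computes_comp1[OF _ computes.succ] r_bus]) (simp_all add: computes_proj)
  show ?thesis unfolding r_psum_def
  proof (rule computes.min)
    have "Suc (pair a b) - triangle (Suc (a + b)) = 0"
      by (simp add: prod_encode_def)
    then show "computes A ?r ((a + b) # [pair a b]) 0" using c by metis
    show "\<forall>m<a + b. \<exists>k. computes A ?r (m # [pair a b]) (Suc k)"
    proof (intro allI impI)
      fix m assume "m < a + b"
      then have "triangle (Suc m) \<le> triangle (a + b)" by (intro triangle_mono) simp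
      then have "Suc (pair a b) - triangle (Suc m) = Suc (pair a b - triangle (Suc m))"
        by (simp add: prod_encode_def Suc_diff_le del: triangle_Suc)
      then show "\<exists>k. computes A ?r (m # [pair a b]) (Suc k)" using c by metis
    qed
  qed
qed

definition "r_p1 = RComp r_bus [RComp r_tri [r_psum], RProj 0]"
definition "r_p2 = RComp r_bus [r_p1, r_psum]"

lemma r_p1: "computes A r_p1 [z] (p1 z)"
proof -
  obtain a b where z: "z = pair a b" by (metis prod_decode_inverse surj_pair)
  have "computes A r_p1 [pair a b] (pair a b - triangle (a + b))" unfolding r_p1_def
    by (rule computes_comp2[where y = "triangle (a + b)" and y' = "pair a b"])
      (auto intro!: computes_comp1[where y = "a + b"] computes_proj r_bus r_tri r_psum)
  moreover have "pair a b - triangle (a + b) = a" by (simp add: prod_encode_def)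
  ultimately show ?thesis by (simp add: z)
qed

lemma r_p2: "computes A r_p2 [z] (p2 z)"
proof -
  obtain a b where z: "z = pair a b" by (metis prod_decode_inverse surj_pair)
  have "computes A r_p2 [pair a b] (a + b - a)" unfolding r_p2_def
    by (rule computes_comp2[where y = a and y' = "a + b"])
      (use r_p1[of A "pair a b"] r_bus[of A a "a + b"] r_psum in auto)
  then show ?thesis by (simp add: z)
qed

fun r_const :: "nat \<Rightarrow> recf" where
  "r_const 0 = RZero"
| "r_const (Suc n) = RComp RSucc [r_const n]"

lemma r_const: "computes A (r_const n) xs n"
  by (induction n) (auto intro: computes.zero computes.succ computes_comp1)

section \<open>Closure properties of oracle-computable functions and relations\<close>

lemma orec_const [orec_intros]: "orec (\<lambda>A x. c)"
  unfolding orec_def using r_const by blast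

lemma orec_id [orec_intros]: "orec (\<lambda>A x. x)"
  unfolding orec_def by (rule exI[of _ "RProj 0"]) (simp add: computes_proj)

lemma orec_comp: "orec F \<Longrightarrow> orec G \<Longrightarrow> orec (\<lambda>A x. F A (G A x))"
  unfolding orec_def using computes_comp1 by metis

lemma orec_comp2:
  assumes "\<And>A a b. computes A r [a, b] (F a b)" "orec G" "orec H"
  shows "orec (\<lambda>A x. F (G A x) (H A x))"
proof -
  obtain g h where "\<And>A x. computes A g [x] (G A x)" "\<And>A x. computes A h [x] (H A x)"
    using assms(2,3) unfolding orec_def by meson
  then have "computes A (RComp r [g, h]) [x] (F (G A x) (H A x))" for A x
    by (rule computes_comp2[OF _ _ assms(1)])
  then show ?thesis unfolding orec_def by blast
qed

lemma orec_comp1: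
  assumes "\<And>A a. computes A r [a] (F a)" "orec G"
  shows "orec (\<lambda>A x. F (G A x))"
  using assms unfolding orec_def using computes_comp1 by metis

lemmas orec_Suc [orec_intros] = orec_comp1[OF computes.succ]
lemmas orec_p1 [orec_intros] = orec_comp1[OF r_p1]
lemmas orec_p2 [orec_intros] = orec_comp1[OF r_p2]
lemmas orec_add [orec_intros] = orec_comp2[OF r_add]
lemmas orec_mult [orec_intros] = orec_comp2[OF r_mult]
lemmas orec_pair [orec_intros] = orec_comp2[OF r_pair]

lemma orec_diff [orec_intros]: "orec G \<Longrightarrow> orec H \<Longrightarrow> orec (\<lambda>A x. G A x - H A x)"
  using orec_comp2[OF r_bus] .

lemma odec_query [orec_intros]:
  assumes "orec G" shows "odec (\<lambda>A x. G A x \<in> A)"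
proof -
  have "orec (\<lambda>A x. if x \<in> A then 1 else 0)"
    unfolding orec_def using computes.query by metis
  from orec_comp[OF this assms] show ?thesis unfolding odec_def .
qed

lemma orec_rec_nat [orec_intros]:
  assumes "orec F" "orec (\<lambda>A z. G A (p1 z) (p1 (p2 z)) (p2 (p2 z)))" "orec N"
  shows "orec (\<lambda>A x. rec_nat (F A x) (\<lambda>i r. G A i r x) (N A x))"
proof -
  obtain f where f: "\<And>A x. computes A f [x] (F A x)" using assms(1) orec_def by metis
  obtain g where g: "\<And>A z. computes A g [z] (G A (p1 z) (p1 (p2 z)) (p2 (p2 z)))"
    using assms(2) orec_def[of "\<lambda>A z. G A (p1 z) (p1 (p2 z)) (p2 (p2 z))"] by metis
  \<comment> \<open>\<open>orec\<close> concerns unary functions, so loop index, previous value and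
    parameter are packed into one argument.\<close>
  define g' where "g' = RComp g [RComp r_pair [RProj 0, RComp r_pair [RProj 1, RProj 2]]]"
  have g': "computes A g' [i, r, x] (G A i r x)" for A i r x
    unfolding g'_def by (rule computes_comp1[OF computes_comp2[OF _ computes_comp2[OF _ _ r_pair] r_pair]])
      (use g[of A "pair i (pair r x)"] in \<open>simp_all add: computes_proj\<close>)
  have "computes A (RPrim f g') [n, x] (rec_nat (F A x) (\<lambda>i r. G A i r x) n)" for A n x
    by (induction n) (auto intro: prim_0 prim_Suc f g')
  then have "computes A (RComp (RPrim f g') [h, RProj 0]) [x]
      (rec_nat (F A x) (\<lambda>i r. G A i r x) m)" if "computes A h [x] m" for A h x m
    by (intro computes_comp2[OF that]) (auto simp: computes_proj)
  then show ?thesis using assms(3) unfolding orec_def by meson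
qed

lemma orec_case0:
  assumes "orec B" "orec F" "orec G"
  shows "orec (\<lambda>A x. if B A x = 0 then F A x else G A x)"
proof -
  have "orec (\<lambda>A x. rec_nat (F A x) (\<lambda>i r. G A x) (B A x))"
    by (intro orec_rec_nat assms(1,2) orec_comp[OF assms(3), of "\<lambda>A z. p2 (p2 z)"] orec_intros)
  moreover have "rec_nat a (\<lambda>i r. b) n = (if n = 0 then a else b)" for a b :: nat and n
    by (cases n) auto
  ultimately show ?thesis by simp
qed

lemma orec_if [orec_intros]:
  assumes "odec P" "orec F" "orec G"
  shows "orec (\<lambda>A x. if P A x then F A x else G A x)"
proof -
  have "(if (if a then 1 else 0::nat) = 0 then c else b) = (if a then b else c)" for a and b c :: nat
    by simp
  then show ?thesis using orec_case0[OF assms(1)[unfolded odec_def] assms(3,2)] by simp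
qed

lemma odec_zero: "orec F \<Longrightarrow> odec (\<lambda>A x. F A x = 0)"
  unfolding odec_def by (intro orec_case0 orec_const)

lemma odec_not [orec_intros]:
  assumes "odec P" shows "odec (\<lambda>A x. \<not> P A x)"
proof -
  have "(if a then 1 else 0::nat) = 0 \<longleftrightarrow> \<not> a" for a by simp
  then show ?thesis using odec_zero[OF assms[unfolded odec_def]] by simp
qed

lemma odec_conj [orec_intros]:
  assumes "odec P" "odec Q" shows "odec (\<lambda>A x. P A x \<and> Q A x)"
proof -
  have "orec (\<lambda>A x. if P A x then if Q A x then 1 else 0 else 0)"
    by (intro orec_if assms orec_const assms(2)[unfolded odec_def])
  moreover have "(if a then if b then 1 else 0 else 0) = (if a \<and> b then 1 else 0::nat)" for a b
    by simp
  ultimately show ?thesis unfolding odec_def by simp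
qed

lemma odec_comp: "odec P \<Longrightarrow> orec G \<Longrightarrow> odec (\<lambda>A x. P A (G A x))"
  unfolding odec_def by (rule orec_comp[of "\<lambda>A x. if P A x then 1 else 0"])

lemma odec_disj [orec_intros]: "odec P \<Longrightarrow> odec Q \<Longrightarrow> odec (\<lambda>A x. P A x \<or> Q A x)"
  using odec_not[OF odec_conj[OF odec_not odec_not], of P Q] by simp

lemma odec_imp [orec_intros]: "odec P \<Longrightarrow> odec Q \<Longrightarrow> odec (\<lambda>A x. P A x \<longrightarrow> Q A x)"
  unfolding imp_conv_disj by (intro odec_disj odec_not)

lemma odec_le [orec_intros]: "orec F \<Longrightarrow> orec G \<Longrightarrow> odec (\<lambda>A x. F A x \<le> G A x)"
  using odec_zero[OF orec_diff, of F G] by simp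

lemma odec_less [orec_intros]: "orec F \<Longrightarrow> orec G \<Longrightarrow> odec (\<lambda>A x. F A x < G A x)"
  using odec_le[OF orec_Suc, of F G] by (simp add: Suc_le_eq)

lemma odec_eq [orec_intros]: "orec F \<Longrightarrow> orec G \<Longrightarrow> odec (\<lambda>A x. F A x = G A x)"
  using odec_conj[OF odec_le odec_le, of F G G F] by (simp add: order_eq_iff)

lemma odec_all_less [orec_intros]:
  assumes "odec (\<lambda>A z. P A (p1 z) (p2 z))" "orec N"
  shows "odec (\<lambda>A x. \<forall>i<N A x. P A i x)"
proof -
  have "odec (\<lambda>A z. P A (p1 z) (p2 (p2 z)))"
    using odec_comp[OF assms(1), of "\<lambda>A z. pair (p1 z) (p2 (p2 z))"]
    by (simp add: orec_intros)
  then have "orec (\<lambda>A x. rec_nat 1 (\<lambda>i r. if P A i x then r else 0) (N A x))"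
    using assms(2) by (intro orec_intros)
  moreover have "rec_nat 1 (\<lambda>i r. if P A i x then r else 0) n = (if \<forall>i<n. P A i x then 1 else 0::nat)"
    for A n x
    by (induction n) (auto simp: less_Suc_eq)
  ultimately show ?thesis by (simp add: odec_def)
qed

lemma odec_ex_less [orec_intros]:
  assumes "odec (\<lambda>A z. P A (p1 z) (p2 z))" "orec N"
  shows "odec (\<lambda>A x. \<exists>i<N A x. P A i x)"
  using odec_not[OF odec_all_less[OF odec_not[OF assms(1)] assms(2)]] by simp

lemma odec_all_le [orec_intros]:
  assumes "odec (\<lambda>A z. P A (p1 z) (p2 z))" "orec N"
  shows "odec (\<lambda>A x. \<forall>i\<le>N A x. P A i x)"
  using odec_all_less[OF assms(1) orec_Suc[OF assms(2)]] by (simp add: less_Suc_eq_le)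

text \<open>Totality is not assumed: the program halts exactly when a witness exists. This is how a
  halting question put to a jump expresses an existential quantifier.\<close>

lemma program_search:
  assumes "odec (\<lambda>A z. P A (p1 z) (p2 z))"
  obtains r where "\<And>A x n. computes A r [x] n \<longleftrightarrow> P A n x \<and> (\<forall>m<n. \<not> P A m x)"
proof -
  obtain f where f: "\<And>A z. computes A f [z] (if \<not> P A (p1 z) (p2 z) then 1 else 0)"
    using odec_not[OF assms] unfolding odec_def orec_def by meson
  let ?f = "RComp f [r_pair]"
  have f': "computes A ?f [n, x] (if \<not> P A n x then 1 else 0)" for A n x
    by (rule computes_comp1[OF r_pair]) (use f[of A "pair n x"] in simp)
  have ev: "computes A ?f [n, x] y \<longleftrightarrow> y = (if \<not> P A n x then 1 else 0)" for A n x y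
    using computes_deterministic[OF _ f'[of A n x]] f'[of A n x] by blast
  have "computes A (RMin ?f) [x] n \<longleftrightarrow> P A n x \<and> (\<forall>m<n. \<not> P A m x)" for A x n
  proof
    assume "computes A (RMin ?f) [x] n"
    then show "P A n x \<and> (\<forall>m<n. \<not> P A m x)"
      by cases (auto simp: ev split: if_splits)
  qed (auto intro!: computes.min simp: ev)
  then show ?thesis using that by blast
qed

lemma orec_Least:
  assumes "odec (\<lambda>A z. P A (p1 z) (p2 z))" "\<And>A x. \<exists>n. P A n x"
  shows "orec (\<lambda>A x. LEAST n. P A n x)"
proof -
  obtain r where r: "\<And>A x n. computes A r [x] n \<longleftrightarrow> P A n x \<and> (\<forall>m<n. \<not> P A m x)"
    using program_search[OF assms(1)] by blast
  have "computes A r [x] (LEAST n. P A n x)" for A x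
    using assms(2)[of A x] unfolding r by (auto intro: LeastI_ex dest: not_less_Least)
  then show ?thesis unfolding orec_def by blast
qed

lemma orec_div2 [orec_intros]: "orec F \<Longrightarrow> orec (\<lambda>A x. F A x div 2)"
proof -
  assume "orec F"
  then have "orec (\<lambda>A x. rec_nat 0 (\<lambda>i r. if 2 * r + 1 < Suc i then Suc r else r) (F A x))"
    by (intro orec_intros)
  moreover have "rec_nat 0 (\<lambda>i r. if 2 * r + 1 < Suc i then Suc r else r) n = n div 2" for n :: nat
    by (induction n) auto
  ultimately show ?thesis by simp
qed

lemma odec_even [orec_intros]: "orec F \<Longrightarrow> odec (\<lambda>A x. even (F A x))"
proof -
  assume "orec F"
  then have "odec (\<lambda>A x. 2 * (F A x div 2) = F A x)" by (intro orec_intros)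
  moreover have "2 * (n div 2) = n \<longleftrightarrow> even n" for n :: nat by presburger
  ultimately show ?thesis by simp
qed

section \<open>Codes of finite sequences\<close>

definition len :: "nat \<Rightarrow> nat" where "len s = length (list_decode s)"

definition nth_code :: "nat \<Rightarrow> nat \<Rightarrow> nat" where
  "nth_code s i = p1 (list_encode (drop i (list_decode s)) - 1)"

lemma len_encode [simp]: "len (list_encode xs) = length xs"
  by (simp add: len_def)

lemma nth_code_encode [simp]: "i < length xs \<Longrightarrow> nth_code (list_encode xs) i = xs ! i"
  by (simp add: nth_code_def Cons_nth_drop_Suc[symmetric])

lemma orec_drop:
  assumes "orec S" "orec I"
  shows "orec (\<lambda>A x. list_encode (drop (I A x) (list_decode (S A x))))"
proof -
  have "orec (\<lambda>A x. rec_nat (S A x) (\<lambda>i r. p2 (r - 1)) (I A x))"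
    using assms by (intro orec_intros)
  moreover have "p2 (list_encode ys - 1) = list_encode (drop 1 ys)" for ys
  proof (cases ys)
    case Nil
    \<comment> \<open>The empty list has code 0, which is also \<open>pair 0 0\<close>, so taking
      tails past the end stays at 0.\<close>
    have "pair 0 0 = 0" by (simp add: prod_encode_def)
    then have "prod_decode 0 = (0, 0)" by (metis prod_encode_inverse)
    then show ?thesis using Nil by simp
  qed simp
  then have "rec_nat s (\<lambda>i r. p2 (r - 1)) n = list_encode (drop n (list_decode s))" for n s
    by (induction n) auto
  ultimately show ?thesis by simp
qed

lemma orec_nth_code [orec_intros]:
  "orec S \<Longrightarrow> orec I \<Longrightarrow> orec (\<lambda>A x. nth_code (S A x) (I A x))"
  unfolding nth_code_def by (intro orec_intros orec_drop)

lemma orec_len [orec_intros]: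
  assumes "orec S" shows "orec (\<lambda>A x. len (S A x))"
proof -
  have "orec (\<lambda>A s. LEAST i. list_encode (drop i (list_decode s)) = 0)"
  proof (rule orec_Least)
    show "odec (\<lambda>A z. list_encode (drop (p1 z) (list_decode (p2 z))) = 0)"
      by (intro orec_intros orec_drop)
    show "\<exists>n. list_encode (drop n (list_decode s)) = 0" for s
      by (rule exI[of _ "length (list_decode s)"]) simp
  qed
  moreover have "list_encode xs = 0 \<longleftrightarrow> xs = []" for xs by (cases xs) auto
  then have "(LEAST i. list_encode (drop i (list_decode s)) = 0) = len s" for s
    unfolding len_def by (intro Least_equality) auto
  ultimately show ?thesis using orec_comp[OF _ assms] by simp
qed

lemma orec_map_upt [orec_intros]:
  assumes "orec (\<lambda>A z. h A (p1 z) (p2 z))" "orec N"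
  shows "orec (\<lambda>A x. list_encode (map (\<lambda>i. h A i x) [0..<N A x]))"
proof -
  \<comment> \<open>Lists grow at the front, so step \<open>i\<close> of the recursion contributes
    the entry with index \<open>N - Suc i\<close>.\<close>
  have h: "orec (\<lambda>A z. h A (N A (p2 (p2 z)) - Suc (p1 z)) (p2 (p2 z)))"
    using orec_comp[OF assms(1), of "\<lambda>A z. pair (N A (p2 (p2 z)) - Suc (p1 z)) (p2 (p2 z))"]
      orec_comp[OF assms(2), of "\<lambda>A z. p2 (p2 z)"]
    by (simp add: orec_intros)
  then have "orec (\<lambda>A x. rec_nat 0 (\<lambda>i r. Suc (pair (h A (N A x - Suc i) x) r)) (N A x))"
    using assms by (intro orec_intros)
  moreover have "rec_nat 0 (\<lambda>i r. Suc (pair (h A (n - Suc i) x) r)) k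
      = list_encode (map (\<lambda>i. h A i x) [n - k..<n])" if "k \<le> n" for A x k n
    using that
  proof (induction k)
    case (Suc k)
    then have "[n - Suc k..<n] = (n - Suc k) # [n - k..<n]"
      by (metis Suc_diff_Suc Suc_le_lessD diff_less less_le_trans upt_conv_Cons zero_less_Suc le0 lessI)
    then show ?case using Suc by simp
  qed simp
  ultimately show ?thesis by simp
qed

subsection \<open>Recursive games\<close>

lemma computes_comp1_iff:
  assumes "computes A g xs w"
  shows "computes A (RComp f [g]) xs y \<longleftrightarrow> computes A f [w] y"
proof
  assume "computes A (RComp f [g]) xs y"
  then show "computes A f [w] y"
  proof cases
    case (comp ys)
    then have "ys = [w]"
      using computes_deterministic[OF assms] by (cases ys) auto
    then show ?thesis using comp by simp
  qed
qed (rule computes_comp1[OF assms])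

lemma orec_code_const [orec_intros]:
  assumes "orec F" shows "orec (\<lambda>A x. code (r_const (F A x)))"
proof -
  \<comment> \<open>The numbers are those of \<open>code\<close>: tag 4 for \<open>RComp\<close>,
    \<open>pair 1 0\<close> for \<open>RSucc\<close>, and \<open>Suc (pair r 0)\<close> for the list
    with single entry \<open>r\<close>.\<close>
  have "orec (\<lambda>A x. rec_nat (pair 0 0) (\<lambda>i r. pair 4 (pair (pair 1 0) (Suc (pair r 0)))) (F A x))"
    using assms by (intro orec_intros)
  moreover have "rec_nat (pair 0 0) (\<lambda>i r. pair 4 (pair (pair 1 0) (Suc (pair r 0)))) n
      = code (r_const n)" for n
    by (induction n) simp_all
  ultimately show ?thesis by simp
qed

text \<open>The second recursion theorem by self-application of codes; no universal program is needed
  because the code of a program with one argument fixed is computable from the code.\<close>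

lemma recursion_theorem:
  obtains r where "\<And>A s y. computes A r [s] y \<longleftrightarrow> computes A u [pair (code r) s] y"
proof -
  \<comment> \<open>If \<open>e\<close> codes \<open>f\<close>, then \<open>sm e\<close> codes
    \<open>RComp f [RComp r_pair [r_const e, RProj 0]]\<close>, which runs \<open>f\<close> on its
    input paired with the code of \<open>f\<close> itself.\<close>
  define sm where "sm e = pair 4 (pair e (Suc (pair
    (pair 4 (pair (code r_pair) (Suc (pair (code (r_const e)) (Suc (pair (pair 2 0) 0)))))) 0)))" for e
  have "orec (\<lambda>A z. pair (sm (p1 z)) (p2 z))"
    unfolding sm_def by (intro orec_intros)
  then obtain g where g: "\<And>A z. computes A g [z] (pair (sm (p1 z)) (p2 z))"
    unfolding orec_def by blast
  define v where "v = RComp u [g]"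
  \<comment> \<open>\<open>r\<close> hands \<open>code v\<close> to \<open>v\<close>, which replaces
    it by \<open>sm (code v)\<close> before running \<open>u\<close>; that number is the code of
    \<open>r\<close>.\<close>
  define r where "r = RComp v [RComp r_pair [r_const (code v), RProj 0]]"
  have code_r: "code r = sm (code v)" by (simp add: r_def sm_def)
  have c: "computes A (RComp r_pair [r_const (code v), RProj 0]) [s] (pair (code v) s)" for A s
    by (rule computes_comp2[OF r_const _ r_pair]) (simp add: computes_proj)
  have "computes A r [s] y \<longleftrightarrow> computes A v [pair (code v) s] y" for A s y
    unfolding r_def by (rule computes_comp1_iff[OF c])
  moreover have "computes A v [pair (code v) s] y \<longleftrightarrow> computes A u [pair (code r) s] y" for A s y
    using computes_comp1_iff[OF g[of A "pair (code v) s"], of u y] by (simp add: v_def[symmetric] code_r)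
  ultimately have "computes A r [s] y \<longleftrightarrow> computes A u [pair (code r) s] y" for A s y
    by simp
  then show ?thesis using that by blast
qed

text \<open>The level at \<open>a\<close> refers only to levels strictly below \<open>a\<close>, so
  recursion along the strict part \<open>r - Id\<close> defines it.\<close>

lemma jump_hierarchy_exists:
  assumes "wf (r - Id)"
  shows "\<exists>H. jump_hierarchy r H"
proof -
  let ?F = "\<lambda>H a. {pair b m | b m. (b, a) \<in> r \<and> b \<noteq> a \<and> m \<in> turing_jump (H b)}"
  have "wfrec (r - Id) ?F a = ?F (wfrec (r - Id) ?F) a" for a
    by (subst wfrec[OF assms]) (auto simp: cut_def)
  then show ?thesis unfolding jump_hierarchy_def by blast
qed

text \<open>The Kleene--Brouwer order, in which proper extensions come first.\<close>

fun kb :: "nat list \<Rightarrow> nat list \<Rightarrow> bool" where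
  "kb [] t \<longleftrightarrow> False"
| "kb (x # s) [] \<longleftrightarrow> True"
| "kb (x # s) (y # t) \<longleftrightarrow> x < y \<or> x = y \<and> kb s t"

lemma kb_irrefl: "\<not> kb s s"
  by (induction s) auto

lemma kb_trans: "kb s t \<Longrightarrow> kb t u \<Longrightarrow> kb s u"
  by (induction s t arbitrary: u rule: kb.induct) (case_tac u; auto)+

lemma kb_linear: "s \<noteq> t \<Longrightarrow> kb s t \<or> kb t s"
  by (induction s t rule: kb.induct) (case_tac t; auto)+

lemma kb_append: "u \<noteq> [] \<Longrightarrow> kb (s @ u) s"
  by (induction s) (cases u; auto)+

text \<open>A form with bounded quantifiers only, from which decidability of the order on codes is
  read off.\<close>

lemma kb_iff: "kb s t \<longleftrightarrow> (\<exists>k<length s. (\<forall>j<k. j < length t \<and> s ! j = t ! j) \<and>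
    (length t \<le> k \<or> s ! k < t ! k))"
  by (induction s t rule: kb.induct) (auto simp: Ex_less_Suc2 All_less_Suc2)

text \<open>The continuations of \<open>s\<close> form the sum, over first entries \<open>i\<close>,
  of the orders below \<open>s @ [i]\<close>, with the empty continuation on top. Induction over the
  well-founded tree carries well-foundedness from the children to \<open>s\<close>.\<close>

lemma wf_kb:
  assumes pre: "\<And>s i. G (s @ [i]) \<Longrightarrow> G s"
    and wf: "wf {(s @ [i], s) | s i. G (s @ [i])}"
  shows "wf {(a, b). G (s @ a) \<and> G (s @ b) \<and> kb a b}"
  using wf
proof (induction s rule: wf_induct_rule)
  case (less s)
  let ?R = "\<lambda>s. {(a, b). G (s @ a) \<and> G (s @ b) \<and> kb a b}"
  have pre': "G (s @ u) \<Longrightarrow> G s" for s u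
    by (induction u rule: rev_induct) (auto intro: pre simp flip: append_assoc)
  have sub: "wf (?R (s @ [i]))" for i
  proof (cases "G (s @ [i])")
    case True
    then show ?thesis using less by blast
  next
    case False
    then have "?R (s @ [i]) = {}" using pre' by blast
    then show ?thesis by (metis wf_on_bot bot_set_def empty_def)
  qed
  \<comment> \<open>The outer induction is on the first entry, the inner one along the order below
    \<open>s @ [i]\<close>.\<close>
  have acc: "i # c \<in> Wellfounded.acc (?R s)" for i c
  proof (induction i arbitrary: c rule: less_induct)
    case (less i)
    show ?case
      using sub[of i]
    proof (induction c rule: wf_induct_rule)
      case IH: (less c)
      show ?case
      proof (rule accI)
        fix a assume a: "(a, i # c) \<in> ?R s"
        then obtain j d where "a = j # d" "j < i \<or> j = i \<and> kb d c" by (cases a) auto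
        then show "a \<in> Wellfounded.acc (?R s)" using less IH a by auto
      qed
    qed
  qed
  moreover have "[] \<in> Wellfounded.acc (?R s)"
  proof (rule accI)
    fix a assume "(a, []) \<in> ?R s"
    then show "a \<in> Wellfounded.acc (?R s)" using acc by (cases a) auto
  qed
  ultimately have "b \<in> Wellfounded.acc (?R s)" for b by (cases b) auto
  then show ?case by (simp add: wf_iff_acc)
qed

text \<open>\<open>W s\<close> says that the player to move at \<open>s\<close> wins the game in which a player
  without a legal move loses.\<close>

lemma HYP_game:
  assumes dec: "odec (\<lambda>A s. G (list_decode s))"
    and pre: "\<And>s i. G (s @ [i]) \<Longrightarrow> G s"
    and wf: "wf {(s @ [i], s) | s i. G (s @ [i])}"
    and start: "\<And>m. G [m]"
  obtains W where "\<And>s. G s \<Longrightarrow> W s \<longleftrightarrow> (\<exists>i. G (s @ [i]) \<and> \<not> W (s @ [i]))"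
    and "{m. W [m]} \<in> HYP"
proof -
  have root: "G []" using pre[of "[]"] start by simp
  define r where "r = {(list_encode s, list_encode t) | s t. G s \<and> G t \<and> (s = t \<or> kb s t)}"
  have mem_r: "(list_encode s, list_encode t) \<in> r \<longleftrightarrow> G s \<and> G t \<and> (s = t \<or> kb s t)" for s t
    unfolding r_def by (auto simp: list_encode_eq)
  have ex: "\<exists>s. a = list_encode s" for a by (metis list_decode_inverse)
  have Field: "Field r = list_encode ` Collect G"
    unfolding Field_def r_def by (auto simp: image_iff)
  have wf_r: "wf (r - Id)"
  proof -
    have "r - Id = inv_image {(a, b). G ([] @ a) \<and> G ([] @ b) \<and> kb a b} list_decode"
    proof (intro set_eqI)
      fix z show "z \<in> r - Id \<longleftrightarrow> z \<in> inv_image {(a, b). G ([] @ a) \<and> G ([] @ b) \<and> kb a b} list_decode"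
        using ex[of "fst z"] ex[of "snd z"] kb_irrefl
        by (cases z) (auto simp: mem_r list_encode_eq in_inv_image)
    qed
    moreover have "wf {(a, b). G ([] @ a) \<and> G ([] @ b) \<and> kb a b}"
      by (rule wf_kb) (fact pre wf)+
    ultimately show ?thesis using wf_inv_image by simp
  qed
  have "Well_order r"
    unfolding well_order_on_def linear_order_on_def partial_order_on_def preorder_on_def
  proof (intro conjI)
    show "refl_on (Field r) r" by (auto simp: refl_on_def Field mem_r)
    show "trans r"
    proof (rule transI)
      fix x y z assume "(x, y) \<in> r" "(y, z) \<in> r"
      moreover obtain s t u where "x = list_encode s" "y = list_encode t" "z = list_encode u"
        using ex by metis
      ultimately show "(x, z) \<in> r" using kb_trans[of s t u] by (auto simp: mem_r)
    qed
    show "antisym r"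
    proof (rule antisymI)
      fix x y assume "(x, y) \<in> r" "(y, x) \<in> r"
      moreover obtain s t where "x = list_encode s" "y = list_encode t" using ex by metis
      ultimately show "x = y" using kb_trans[of s t s] kb_irrefl[of s] by (auto simp: mem_r)
    qed
    show "total_on (Field r) r" using kb_linear by (auto simp: total_on_def Field mem_r)
  qed (use wf_r in \<open>auto simp: Field_def\<close>)
  have dec': "odec (\<lambda>A x. G (list_decode (F A x)))" if "orec F" for F
    using odec_comp[OF dec that] .
  have kb_code: "kb (list_decode a) (list_decode b) \<longleftrightarrow> (\<exists>k<len a. (\<forall>j<k. j < len b \<and>
      nth_code a j = nth_code b j) \<and> (len b \<le> k \<or> nth_code a k < nth_code b k))" for a b
  proof -
    obtain s t where "a = list_encode s" "b = list_encode t" using ex by metis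
    moreover have "(length t \<le> k \<or> s ! k < t ! k) \<longleftrightarrow> (length t \<le> k \<or>
        nth_code (list_encode s) k < nth_code (list_encode t) k)" if "k < length s" for k
      using that by (cases "k < length t") auto
    moreover have "(\<forall>j<k. j < length t \<and> s ! j = t ! j) \<longleftrightarrow> (\<forall>j<k. j < length t \<and>
        nth_code (list_encode s) j = nth_code (list_encode t) j)" if "k < length s" for k
      using that by (intro all_cong conj_cong refl) simp
    ultimately show ?thesis unfolding kb_iff
      by (simp only: len_encode list_encode_inverse cong: conj_cong)
  qed
  have "odec (\<lambda>A z. G (list_decode (p1 z)) \<and> G (list_decode (p2 z)) \<and>
      (p1 z = p2 z \<or> kb (list_decode (p1 z)) (list_decode (p2 z))))"
    unfolding kb_code by (intro orec_intros dec')
  moreover have "z \<in> prod_encode ` r \<longleftrightarrow> G (list_decode (p1 z)) \<and> G (list_decode (p2 z)) \<and>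
      (p1 z = p2 z \<or> kb (list_decode (p1 z)) (list_decode (p2 z)))" for z
  proof -
    have "z \<in> prod_encode ` r \<longleftrightarrow> prod_decode z \<in> r"
      by (metis image_iff prod_decode_inverse prod_encode_inverse)
    moreover obtain s t where "prod_decode z = (list_encode s, list_encode t)"
      using ex by (metis surj_pair)
    ultimately show ?thesis by (auto simp: mem_r list_encode_eq)
  qed
  ultimately have "odec (\<lambda>A z. z \<in> prod_encode ` r)" by simp
  then have "recursive (prod_encode ` r)"
    unfolding recursive_def turing_le_def odec_def orec_def by blast
  then have rwo: "recursive_well_order r" unfolding recursive_well_order_def using \<open>Well_order r\<close> by blast
  obtain H where H: "jump_hierarchy r H" using jump_hierarchy_exists[OF wf_r] by blast
  define child where "child c s \<longleftrightarrow> len c = Suc (len s) \<and> (\<forall>j<len s. nth_code c j = nth_code s j)" for c s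
  have child: "child (list_encode t) (list_encode s) \<longleftrightarrow> (\<exists>i. t = s @ [i])" for t s
  proof
    assume "child (list_encode t) (list_encode s)"
    then have "t = s @ [t ! length s]"
      by (intro nth_equalityI) (auto simp: child_def nth_append less_Suc_eq)
    then show "\<exists>i. t = s @ [i]" ..
  qed (auto simp: child_def nth_append)
  \<comment> \<open>The program searches for a legal move to a position that is lost for the
    opponent. Its input packs an index \<open>p1 x\<close>, later its own code, with the position
    \<open>p2 x\<close>; the query asks whether program \<open>p1 x\<close> halts at the child
    \<open>n\<close> with the oracle belonging to \<open>n\<close>.\<close>
  have "odec (\<lambda>A z. child (p1 z) (p2 (p2 z)) \<and> G (list_decode (p1 z)) \<and>
      pair (p1 z) (pair (p1 (p2 z)) (p1 z)) \<notin> A)"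
    unfolding child_def by (intro orec_intros dec')
  from program_search[of "\<lambda>A n x. child n (p2 x) \<and> G (list_decode n) \<and>
      pair n (pair (p1 x) n) \<notin> A", OF this]
  obtain u where u: "\<And>A x n. computes A u [x] n \<longleftrightarrow>
      (child n (p2 x) \<and> G (list_decode n) \<and> pair n (pair (p1 x) n) \<notin> A) \<and>
      (\<forall>m<n. \<not> (child m (p2 x) \<and> G (list_decode m) \<and> pair m (pair (p1 x) m) \<notin> A))"
    by blast
  obtain p where p: "\<And>A s y. computes A p [s] y \<longleftrightarrow> computes A u [pair (code p) s] y"
    using recursion_theorem by blast
  define win where "win s \<longleftrightarrow> (\<exists>y. computes (H (list_encode s)) p [list_encode s] y)" for s
  \<comment> \<open>Children precede \<open>s\<close> in the order, so the level at \<open>s\<close>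
    contains the halting answers for them. Injectivity of \<open>code\<close> ensures that the
    answer is about \<open>p\<close>.\<close>
  have inH: "pair (list_encode t) (pair (code p) (list_encode t)) \<in> H (list_encode s) \<longleftrightarrow> win t"
    if "G s" "G t" "kb t s" for s t
  proof -
    have "H (list_encode s) = {pair b m | b m. (b, list_encode s) \<in> r \<and> b \<noteq> list_encode s
        \<and> m \<in> turing_jump (H b)}"
      using H that unfolding jump_hierarchy_def Field by blast
    moreover have "(list_encode t, list_encode s) \<in> r" "list_encode t \<noteq> list_encode s"
      using that kb_irrefl by (auto simp: mem_r list_encode_eq)
    ultimately show ?thesis
      by (auto simp: turing_jump_def win_def dest: code_inject)
  qed
  have win: "win s \<longleftrightarrow> (\<exists>i. G (s @ [i]) \<and> \<not> win (s @ [i]))" if "G s" for s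
  proof -
    let ?P = "\<lambda>n. child n (list_encode s) \<and> G (list_decode n) \<and>
      pair n (pair (code p) n) \<notin> H (list_encode s)"
    have "win s \<longleftrightarrow> (\<exists>n. ?P n \<and> (\<forall>m<n. \<not> ?P m))"
      by (simp add: win_def p u)
    also have "\<dots> \<longleftrightarrow> (\<exists>n. ?P n)" by (rule exists_least_iff[symmetric])
    also have "\<dots> \<longleftrightarrow> (\<exists>t. ?P (list_encode t))" using ex by metis
    also have "\<dots> \<longleftrightarrow> (\<exists>i. G (s @ [i]) \<and> \<not> win (s @ [i]))"
      using inH[OF that] kb_append[of "[_]" s] by (auto simp: child)
    finally show ?thesis .
  qed
  \<comment> \<open>The root has code 0 and is the greatest position, and
    \<open>Suc (pair m 0)\<close> is the code of \<open>[m]\<close>; one query to \<open>H 0\<close>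
    tells who wins there.\<close>
  have "win [m] \<longleftrightarrow> pair (Suc (pair m 0)) (pair (code p) (Suc (pair m 0))) \<in> H 0" for m
    using inH[OF root start, of m] start[of m] by simp
  moreover have "odec (\<lambda>A m. pair (Suc (pair m 0)) (pair (code p) (Suc (pair m 0))) \<in> A)"
    by (intro orec_intros)
  then obtain f where "\<And>A m. computes A f [m]
      (if pair (Suc (pair m 0)) (pair (code p) (Suc (pair m 0))) \<in> A then 1 else 0)"
    unfolding odec_def orec_def by blast
  ultimately have "turing_le {m. win [m]} (H 0)"
    unfolding turing_le_def by (intro exI[of _ f]) simp
  moreover have "0 \<in> Field r" using root by (auto simp: Field image_iff intro: exI[of _ "[]"])
  ultimately have "{m. win [m]} \<in> HYP" unfolding HYP_def using rwo H by blast
  with win show ?thesis by (rule that)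
qed

subsection \<open>Effectively closed sets\<close>

definition initial :: "(nat \<Rightarrow> nat) \<Rightarrow> nat \<Rightarrow> nat" where
  "initial g k = list_encode (map g [0..<k])"

lemma len_initial [simp]: "len (initial g k) = k"
  by (simp add: initial_def)

lemma nth_code_initial [simp]: "i < k \<Longrightarrow> nth_code (initial g k) i = g i"
  by (simp add: initial_def)

text \<open>\<open>\<phi>\<close> guesses the value \<open>F g x\<close> from \<open>x\<close> and an initial segment of \<open>g\<close>; the answer \<open>0\<close> means
  that the segment is too short.\<close>

definition approximates :: "(nat \<Rightarrow> nat) \<Rightarrow> ((nat \<Rightarrow> nat) \<Rightarrow> nat \<Rightarrow> nat) \<Rightarrow> bool" where
  "approximates \<phi> F \<longleftrightarrow> (\<forall>g x.
    (\<forall>k. \<phi> (pair (initial g k) x) = 0 \<or> \<phi> (pair (initial g k) x) = Suc (F g x)) \<and>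
    (\<exists>k0. \<forall>k\<ge>k0. \<phi> (pair (initial g k) x) = Suc (F g x)))"

text \<open>Programs as defined above query sets, whereas the argument here is a function. Guessing
  from initial segments replaces function oracles and makes continuity explicit.\<close>

definition ceff :: "((nat \<Rightarrow> nat) \<Rightarrow> nat \<Rightarrow> nat) \<Rightarrow> bool" where
  "ceff F \<longleftrightarrow> (\<exists>\<phi>. crec \<phi> \<and> approximates \<phi> F)"

definition cdec :: "((nat \<Rightarrow> nat) \<Rightarrow> nat \<Rightarrow> bool) \<Rightarrow> bool" where
  "cdec P \<longleftrightarrow> ceff (\<lambda>g x. if P g x then 1 else 0)"

named_theorems ceff_intros

lemma approximatesD:
  assumes "approximates \<phi> F"
  shows "\<phi> (pair (initial g k) x) = 0 \<or> \<phi> (pair (initial g k) x) = Suc (F g x)"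
    and "\<exists>k0. \<forall>k\<ge>k0. \<phi> (pair (initial g k) x) = Suc (F g x)"
  using assms unfolding approximates_def by auto

lemma ceffI:
  assumes "crec \<phi>"
    and "\<And>g x k. \<phi> (pair (initial g k) x) \<noteq> 0 \<Longrightarrow> \<phi> (pair (initial g k) x) = Suc (F g x)"
    and "\<And>g x. \<exists>k0. \<forall>k\<ge>k0. \<phi> (pair (initial g k) x) \<noteq> 0"
  shows "ceff F"
  unfolding ceff_def approximates_def using assms by (intro exI[of _ \<phi>]) metis

section \<open>Closure properties of computable functionals\<close>

lemma ceff_crec: "crec h \<Longrightarrow> ceff (\<lambda>g. h)"
  by (rule ceffI[of "\<lambda>z. Suc (h (p2 z))"]) (auto intro!: orec_intros orec_comp[of "\<lambda>A. h"])

lemma ceff_apply: "ceff (\<lambda>g x. g x)"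
proof (rule ceffI[of "\<lambda>z. if p2 z < len (p1 z) then Suc (nth_code (p1 z) (p2 z)) else 0"])
  fix g :: "nat \<Rightarrow> nat" and x
  show "\<exists>k0. \<forall>k\<ge>k0. (if p2 (pair (initial g k) x) < len (p1 (pair (initial g k) x))
      then Suc (nth_code (p1 (pair (initial g k) x)) (p2 (pair (initial g k) x))) else 0) \<noteq> 0"
    by (intro exI[of _ "Suc x"]) simp
qed (auto intro!: orec_intros split: if_splits)

lemma ceff_comp:
  assumes "ceff F" "ceff H" shows "ceff (\<lambda>g x. F g (H g x))"
proof -
  obtain f h where f: "crec f" "approximates f F" and h: "crec h" "approximates h H"
    using assms unfolding ceff_def by blast
  show ?thesis
  proof (rule ceffI[of "\<lambda>z. if h z = 0 then 0 else f (pair (p1 z) (h z - 1))"])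
    show "crec (\<lambda>z. if h z = 0 then 0 else f (pair (p1 z) (h z - 1)))"
      by (intro orec_intros h orec_comp[OF f(1)])
    fix g x
    show "(if h (pair (initial g k) x) = 0 then 0
        else f (pair (p1 (pair (initial g k) x)) (h (pair (initial g k) x) - 1))) = Suc (F g (H g x))"
      if "(if h (pair (initial g k) x) = 0 then 0
        else f (pair (p1 (pair (initial g k) x)) (h (pair (initial g k) x) - 1))) \<noteq> 0" for k
      using that approximatesD(1)[OF h(2), of g k x] approximatesD(1)[OF f(2), of g k "H g x"]
      by (auto split: if_splits)
    obtain k0 where "\<forall>k\<ge>k0. h (pair (initial g k) x) = Suc (H g x)"
      using approximatesD(2)[OF h(2)] by blast
    moreover obtain k1 where "\<forall>k\<ge>k1. f (pair (initial g k) (H g x)) = Suc (F g (H g x))"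
      using approximatesD(2)[OF f(2)] by blast
    ultimately show "\<exists>k0. \<forall>k\<ge>k0. (if h (pair (initial g k) x) = 0 then 0
        else f (pair (p1 (pair (initial g k) x)) (h (pair (initial g k) x) - 1))) \<noteq> 0"
      by (intro exI[of _ "max k0 k1"]) simp
  qed
qed

lemma ceff_pair [ceff_intros]:
  assumes "ceff F" "ceff H" shows "ceff (\<lambda>g x. pair (F g x) (H g x))"
proof -
  obtain f h where f: "crec f" "approximates f F" and h: "crec h" "approximates h H"
    using assms unfolding ceff_def by blast
  let ?\<phi> = "\<lambda>z. if f z = 0 \<or> h z = 0 then 0 else Suc (pair (f z - 1) (h z - 1))"
  show ?thesis
  proof (rule ceffI[of ?\<phi>])
    show "crec ?\<phi>" by (intro orec_intros h f)
    fix g x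
    show "?\<phi> (pair (initial g k) x) = Suc (pair (F g x) (H g x))" if "?\<phi> (pair (initial g k) x) \<noteq> 0" for k
      using that approximatesD(1)[OF h(2), of g k x] approximatesD(1)[OF f(2), of g k x]
      by (auto split: if_splits)
    obtain k0 where "\<forall>k\<ge>k0. h (pair (initial g k) x) = Suc (H g x)"
      using approximatesD(2)[OF h(2)] by blast
    moreover obtain k1 where "\<forall>k\<ge>k1. f (pair (initial g k) x) = Suc (F g x)"
      using approximatesD(2)[OF f(2)] by blast
    ultimately show "\<exists>k0. \<forall>k\<ge>k0. ?\<phi> (pair (initial g k) x) \<noteq> 0"
      by (intro exI[of _ "max k0 k1"]) simp
  qed
qed

text \<open>Applies a functional to a function that is itself computed from \<open>g\<close>. This
  is how rows are renamed and witnesses are moved into place later.\<close>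

lemma ceff_subst:
  assumes "ceff F" "ceff (\<lambda>g z. H g (p1 z) (p2 z))" "ceff A"
  shows "ceff (\<lambda>g x. F (\<lambda>j. H g x j) (A g x))"
proof -
  obtain f h a where f: "crec f" "approximates f F"
    and h: "crec h" "approximates h (\<lambda>g z. H g (p1 z) (p2 z))" and a: "crec a" "approximates a A"
    using assms unfolding ceff_def by blast
  \<comment> \<open>\<open>L s x\<close> counts the leading values of \<open>H g x\<close> that the
    segment \<open>s\<close> already determines. The cap \<open>len s\<close> makes the search
    end.\<close>
  define L where "L s x = (LEAST k. len s \<le> k \<or> h (pair s (pair x k)) = 0)" for s x
  define \<phi> where "\<phi> z = (if a z = 0 then 0 else
    f (pair (list_encode (map (\<lambda>j. h (pair (p1 z) (pair (p2 z) j)) - 1) [0..<L (p1 z) (p2 z)])) (a z - 1)))" for z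
  have "crec (\<lambda>z. L (p1 z) (p2 z))"
    unfolding L_def
  proof (rule orec_Least)
    show "odec (\<lambda>A z. len (p1 (p2 z)) \<le> p1 z \<or> h (pair (p1 (p2 z)) (pair (p2 (p2 z)) (p1 z))) = 0)"
      by (intro orec_intros orec_comp[OF h(1)])
    show "\<exists>n. len (p1 x) \<le> n \<or> h (pair (p1 x) (pair (p2 x) n)) = 0" for x by blast
  qed
  then have "crec \<phi>"
    unfolding \<phi>_def by (intro orec_intros orec_comp[OF f(1)] orec_comp[OF h(1)] a)
  have L: "k < L (initial g n) x \<Longrightarrow> h (pair (initial g n) (pair x k)) = Suc (H g x k)" for k g n x
    using not_less_Least[of k "\<lambda>k. len (initial g n) \<le> k \<or> h (pair (initial g n) (pair x k)) = 0"]
      approximatesD(1)[OF h(2), of g n "pair x k"] unfolding L_def by auto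
  have \<phi>: "\<phi> (pair (initial g n) x) = (if a (pair (initial g n) x) = 0 then 0
      else f (pair (initial (H g x) (L (initial g n) x)) (A g x)))" for g n x
  proof -
    have "list_encode (map (\<lambda>j. h (pair (initial g n) (pair x j)) - 1) [0..<L (initial g n) x])
        = initial (H g x) (L (initial g n) x)"
      by (auto simp: initial_def[of "H g x"] list_encode_eq dest!: L)
    then show ?thesis
      using approximatesD(1)[OF a(2), of g n x] by (auto simp: \<phi>_def simp del: One_nat_def)
  qed
  show ?thesis
  proof (rule ceffI[OF \<open>crec \<phi>\<close>])
    fix g x
    show "\<phi> (pair (initial g n) x) = Suc (F (\<lambda>j. H g x j) (A g x))" if "\<phi> (pair (initial g n) x) \<noteq> 0" for n
      using that approximatesD(1)[OF f(2), of "H g x" "L (initial g n) x" "A g x"]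
      unfolding \<phi> by (auto split: if_splits)
    obtain k0 where k0: "\<And>k. k \<ge> k0 \<Longrightarrow> f (pair (initial (H g x) k) (A g x)) = Suc (F (H g x) (A g x))"
      using approximatesD(2)[OF f(2)] by blast
    obtain k1 where k1: "\<And>k. k \<ge> k1 \<Longrightarrow> a (pair (initial g k) x) = Suc (A g x)"
      using approximatesD(2)[OF a(2)] by blast
    have "\<exists>k2. \<forall>j<b. \<forall>k\<ge>k2. h (pair (initial g k) (pair x j)) \<noteq> 0" for b
    proof (induction b)
      case (Suc b)
      then obtain k2 where "\<forall>j<b. \<forall>k\<ge>k2. h (pair (initial g k) (pair x j)) \<noteq> 0" by blast
      moreover obtain k3 where "\<forall>k\<ge>k3. h (pair (initial g k) (pair x b)) \<noteq> 0"
        using approximatesD(2)[OF h(2), of g "pair x b"] by (metis nat.distinct(1))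
      ultimately show ?case by (intro exI[of _ "max k2 k3"]) (auto simp: less_Suc_eq)
    qed simp
    then obtain k2 where k2: "\<forall>j<k0. \<forall>k\<ge>k2. h (pair (initial g k) (pair x j)) \<noteq> 0" by blast
    \<comment> \<open>On a long enough segment the cap does no harm: the first \<open>k0\<close>
      values are all known, which is as many as \<open>f\<close> needs for an answer.\<close>
    have "k0 \<le> L (initial g k) x" if "k \<ge> k0" "k \<ge> k2" for k
    proof -
      have "len (initial g k) \<le> L (initial g k) x \<or> h (pair (initial g k) (pair x (L (initial g k) x))) = 0"
        unfolding L_def by (rule LeastI[of _ "len (initial g k)"]) simp
      then show ?thesis using that k2 by (metis le_trans len_initial not_le)
    qed
    then show "\<exists>k0. \<forall>k\<ge>k0. \<phi> (pair (initial g k) x) \<noteq> 0"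
      unfolding \<phi> using k0 k1 by (intro exI[of _ "max (max k0 k1) k2"]) simp
  qed
qed

lemma cdec_subst:
  assumes "cdec P" "ceff (\<lambda>g z. H g (p1 z) (p2 z))" "ceff A"
  shows "cdec (\<lambda>g x. P (\<lambda>j. H g x j) (A g x))"
  using ceff_subst[OF assms(1)[unfolded cdec_def] assms(2,3)] unfolding cdec_def .

lemma ceff_app [ceff_intros]: "ceff H \<Longrightarrow> ceff (\<lambda>g x. g (H g x))"
  by (rule ceff_comp[OF ceff_apply])

lemma ceff_op1:
  assumes "crec f" "ceff F" shows "ceff (\<lambda>g x. f (F g x))"
  by (rule ceff_comp[OF ceff_crec[OF assms(1)] assms(2)])

lemma ceff_op2:
  assumes "crec (\<lambda>z. f (p1 z) (p2 z))" "ceff F" "ceff H" shows "ceff (\<lambda>g x. f (F g x) (H g x))"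
  using ceff_op1[OF assms(1) ceff_pair[OF assms(2,3)]] by simp

lemma cdec_op1:
  assumes "odec (\<lambda>A z. p z)" "ceff F" shows "cdec (\<lambda>g x. p (F g x))"
  unfolding cdec_def by (rule ceff_op1[OF assms(1)[unfolded odec_def] assms(2)])

lemma cdec_op2:
  assumes "odec (\<lambda>A z. p (p1 z) (p2 z))" "ceff F" "ceff H" shows "cdec (\<lambda>g x. p (F g x) (H g x))"
  using cdec_op1[OF assms(1) ceff_pair[OF assms(2,3)]] by simp

lemma ceff_const [ceff_intros]: "ceff (\<lambda>g x. c)" by (rule ceff_crec[OF orec_const])
lemma ceff_id [ceff_intros]: "ceff (\<lambda>g x. x)" by (rule ceff_crec[OF orec_id])
lemmas ceff_p1 [ceff_intros] = ceff_op1[OF orec_p1[OF orec_id]]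
lemmas ceff_p2 [ceff_intros] = ceff_op1[OF orec_p2[OF orec_id]]
lemmas ceff_Suc [ceff_intros] = ceff_op1[OF orec_Suc[OF orec_id]]
lemmas ceff_div2 [ceff_intros] = ceff_op1[OF orec_div2[OF orec_id]]
lemmas ceff_add [ceff_intros] = ceff_op2[OF orec_add[OF orec_p1[OF orec_id] orec_p2[OF orec_id]]]
lemmas ceff_mult [ceff_intros] = ceff_op2[OF orec_mult[OF orec_p1[OF orec_id] orec_p2[OF orec_id]]]
lemmas cdec_even [ceff_intros] = cdec_op1[OF odec_even[OF orec_id]]
lemmas cdec_eq [ceff_intros] = cdec_op2[OF odec_eq[OF orec_p1[OF orec_id] orec_p2[OF orec_id]]]
lemmas cdec_less [ceff_intros] = cdec_op2[OF odec_less[OF orec_p1[OF orec_id] orec_p2[OF orec_id]]]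

lemma ceff_if [ceff_intros]:
  assumes "cdec P" "ceff F" "ceff H" shows "ceff (\<lambda>g x. if P g x then F g x else H g x)"
proof -
  have "crec (\<lambda>z. if p1 z = 0 then p2 (p2 z) else p1 (p2 z))"
    by (intro orec_intros)
  from ceff_op1[OF this ceff_pair[OF assms(1)[unfolded cdec_def] ceff_pair[OF assms(2,3)]]]
  have "ceff (\<lambda>g x. if (if P g x then 1 else 0::nat) = 0 then H g x else F g x)"
    by (simp only: prod_encode_inverse fst_conv snd_conv)
  moreover have "(if (if a then 1 else 0::nat) = 0 then c else b) = (if a then b else c)"
    for a and b c :: nat by simp
  ultimately show ?thesis by (simp only:)
qed

lemma cdec_not [ceff_intros]: 
  assumes "cdec P" shows "cdec (\<lambda>g x. \<not> P g x)"
proof -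
  have "cdec (\<lambda>g x. (if P g x then 1 else 0) = (0::nat))"
    by (intro cdec_eq ceff_const assms[unfolded cdec_def])
  moreover have "(if a then 1 else 0) = (0::nat) \<longleftrightarrow> \<not> a" for a by simp
  ultimately show ?thesis by simp
qed

lemma cdec_conj [ceff_intros]:
  assumes "cdec P" "cdec Q" shows "cdec (\<lambda>g x. P g x \<and> Q g x)"
proof -
  have "ceff (\<lambda>g x. if P g x then if Q g x then 1 else 0 else 0)"
    by (intro ceff_if assms ceff_const assms(2)[unfolded cdec_def])
  moreover have "(if a then if b then 1 else 0 else 0) = (if a \<and> b then 1 else 0::nat)" for a b
    by simp
  ultimately show ?thesis unfolding cdec_def by simp
qed

lemma cdec_disj [ceff_intros]: "cdec P \<Longrightarrow> cdec Q \<Longrightarrow> cdec (\<lambda>g x. P g x \<or> Q g x)"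
  using cdec_not[OF cdec_conj[OF cdec_not cdec_not], of P Q] by simp

section \<open>Lightface closed subsets of Baire space\<close>

definition effclosed :: "(nat \<Rightarrow> nat) set \<Rightarrow> bool" where
  "effclosed K \<longleftrightarrow> (\<exists>P. cdec P \<and> K = {F. \<forall>k. P F k})"

text \<open>A failure of \<open>P\<close> shows in a finite segment, and a definite answer of an
  approximation is never wrong. Forbidding the segments that show a failure leaves exactly
  \<open>K\<close>.\<close>

lemma effclosed_tree:
  assumes "effclosed K"
  obtains D where "odec (\<lambda>A. D)" "K = {F. \<forall>j. D (initial F j)}"
proof -
  obtain P where P: "cdec P" "K = {F. \<forall>k. P F k}" using assms unfolding effclosed_def by blast
  then obtain f where f: "crec f" "approximates f (\<lambda>g x. if P g x then 1 else 0)"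
    unfolding cdec_def ceff_def by blast
  \<comment> \<open>The answer 1 is \<open>Suc 0\<close>, a definite statement that \<open>P\<close>
    fails; 0 says nothing. Bounding \<open>k\<close> by \<open>len s\<close> keeps \<open>D\<close>
    decidable.\<close>
  define D where "D s \<longleftrightarrow> (\<forall>k\<le>len s. f (pair s k) \<noteq> 1)" for s
  have "odec (\<lambda>A. D)"
    unfolding D_def by (intro orec_intros orec_comp[OF f(1)])
  moreover have "K = {F. \<forall>j. D (initial F j)}"
  proof (intro set_eqI iffI)
    fix F assume "F \<in> K"
    then show "F \<in> {F. \<forall>j. D (initial F j)}"
      using approximatesD(1)[OF f(2), of F] by (auto simp: P(2) D_def) (metis Suc_n_not_n One_nat_def)
  next
    fix F assume F: "F \<in> {F. \<forall>j. D (initial F j)}"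
    have "P F k" for k
    proof -
      obtain j0 where "\<forall>j\<ge>j0. f (pair (initial F j) k) = Suc (if P F k then 1 else 0)"
        using approximatesD(2)[OF f(2)] by blast
      moreover have "f (pair (initial F (max j0 k)) k) \<noteq> 1" using F by (simp add: D_def)
      ultimately show ?thesis by (simp split: if_splits)
    qed
    then have "\<forall>k. P F k" by blast
    then show "F \<in> K" by (simp add: P(2))
  qed
  ultimately show ?thesis by (rule that)
qed

text \<open>Topological closedness: \<open>D\<close> inspects one finite segment of \<open>g\<close>
  at a time, and each segment is shared with a member of \<open>K\<close>.\<close>

lemma effclosed_limit:
  assumes "effclosed K" "\<And>k. \<exists>F\<in>K. \<forall>c<k. F c = g c"
  shows "g \<in> K"
proof -
  obtain D where D: "K = {F. \<forall>j. D (initial F j)}" using effclosed_tree[OF assms(1)] .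
  have "D (initial g j)" for j
  proof -
    obtain F where "F \<in> K" "\<forall>c<j. F c = g c" using assms(2) by blast
    then have "initial F j = initial g j" by (auto simp: initial_def list_encode_eq)
    then show ?thesis using \<open>F \<in> K\<close> D by (metis (mono_tags, lifting) mem_Collect_eq)
  qed
  then show ?thesis using D by simp
qed

lemma effclosed_Int: "effclosed K \<Longrightarrow> effclosed L \<Longrightarrow> effclosed (K \<inter> L)"
proof -
  assume "effclosed K" "effclosed L"
  then obtain P Q where "cdec P" "K = {F. \<forall>k. P F k}" "cdec Q" "L = {F. \<forall>k. Q F k}"
    unfolding effclosed_def by blast
  then show ?thesis
    unfolding effclosed_def by (intro exI[of _ "\<lambda>F k. P F k \<and> Q F k"]) (auto intro: cdec_conj)
qed

lemma effclosed_all: "cdec P \<Longrightarrow> effclosed {F. \<forall>k. P F k}"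
  unfolding effclosed_def by blast

lemma effclosed_vimage:
  assumes "effclosed K" "crec h" shows "effclosed {F. F \<circ> h \<in> K}"
proof -
  obtain P where P: "cdec P" "K = {F. \<forall>k. P F k}" using assms unfolding effclosed_def by blast
  have "cdec (\<lambda>F k. P (\<lambda>j. F (h j)) k)"
    by (intro cdec_subst[OF P(1)] ceff_intros ceff_op1[OF assms(2)])
  from effclosed_all[OF this] show ?thesis by (simp add: P(2) comp_def)
qed

definition row :: "(nat \<Rightarrow> nat) \<Rightarrow> nat \<Rightarrow> nat set" where
  "row F i = {m. F (pair i m) \<noteq> 0}"

text \<open>Two players, given \<open>m\<close>, alternately build elements of \<open>K\<close>: the first one an element with
  \<open>m\<close> in row \<open>i\<close>, the second one an element with \<open>m\<close> outside row \<open>i\<close>. If row \<open>i\<close> is constant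
  on \<open>K\<close>, then only one of them can go on forever.\<close>

lemma HYP_row:
  assumes "effclosed K" "K \<noteq> {}" and X: "\<And>F. F \<in> K \<Longrightarrow> row F i = X"
  shows "X \<in> HYP"
proof -
  obtain D where D: "odec (\<lambda>A. D)" "K = {F. \<forall>j. D (initial F j)}" using effclosed_tree[OF assms(1)] .
  \<comment> \<open>A position lists \<open>m\<close>, then alternately values chosen by the first
    player, at places \<open>2 * k + 1\<close>, and by the second, at places
    \<open>2 * k + 2\<close>. Codes and bounded quantifiers make decidability visible;
    \<open>A\<close> and \<open>B\<close> below restate the two players' constraints on
    lists.\<close>
  define G where "G s \<longleftrightarrow> (\<forall>j\<le>len (list_encode s).
      (2 * j \<le> len (list_encode s) \<longrightarrow>
        D (list_encode (map (\<lambda>k. nth_code (list_encode s) (2 * k + 1)) [0..<j])) \<and>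
        (pair i (nth_code (list_encode s) 0) < j \<longrightarrow>
          \<not> nth_code (list_encode s) (2 * pair i (nth_code (list_encode s) 0) + 1) = 0)) \<and>
      (2 * j + 1 \<le> len (list_encode s) \<longrightarrow>
        D (list_encode (map (\<lambda>k. nth_code (list_encode s) (2 * k + 2)) [0..<j])) \<and>
        (pair i (nth_code (list_encode s) 0) < j \<longrightarrow>
          nth_code (list_encode s) (2 * pair i (nth_code (list_encode s) 0) + 2) = 0)))" for s
  have "odec (\<lambda>A s. G (list_decode s))"
    unfolding G_def list_decode_inverse by (intro orec_intros odec_comp[OF D(1)])
  define A where "A s j \<longleftrightarrow> D (list_encode (map (\<lambda>k. s ! (2 * k + 1)) [0..<j])) \<and>
      (pair i (s ! 0) < j \<longrightarrow> s ! (2 * pair i (s ! 0) + 1) \<noteq> 0)" for s j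
  define B where "B s j \<longleftrightarrow> D (list_encode (map (\<lambda>k. s ! (2 * k + 2)) [0..<j])) \<and>
      (pair i (s ! 0) < j \<longrightarrow> s ! (2 * pair i (s ! 0) + 2) = 0)" for s j
  have G: "G s \<longleftrightarrow> (\<forall>j. (2 * j \<le> length s \<longrightarrow> A s j) \<and> (2 * j + 1 \<le> length s \<longrightarrow> B s j))" for s
  proof -
    have mapA: "map (\<lambda>k. nth_code (list_encode s) (2 * k + 1)) [0..<j] = map (\<lambda>k. s ! (2 * k + 1)) [0..<j]"
      if "2 * j \<le> length s" for j
      using that by simp
    have mapB: "map (\<lambda>k. nth_code (list_encode s) (2 * k + 2)) [0..<j] = map (\<lambda>k. s ! (2 * k + 2)) [0..<j]"
      if "2 * j + 1 \<le> length s" for j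
      using that by simp
    have "(D (list_encode (map (\<lambda>k. nth_code (list_encode s) (2 * k + 1)) [0..<j])) \<and>
        (pair i (nth_code (list_encode s) 0) < j \<longrightarrow>
          \<not> nth_code (list_encode s) (2 * pair i (nth_code (list_encode s) 0) + 1) = 0)) \<longleftrightarrow> A s j"
      if "2 * j \<le> length s" for j
    proof (cases "j = 0")
      case False
      then have "0 < length s" using that by linarith
      then have "nth_code (list_encode s) 0 = s ! 0" by (rule nth_code_encode)
      then show ?thesis using that unfolding A_def mapA[OF that] by auto
    qed (simp add: A_def)
    moreover have "(D (list_encode (map (\<lambda>k. nth_code (list_encode s) (2 * k + 2)) [0..<j])) \<and>
        (pair i (nth_code (list_encode s) 0) < j \<longrightarrow>
          nth_code (list_encode s) (2 * pair i (nth_code (list_encode s) 0) + 2) = 0)) \<longleftrightarrow> B s j"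
      if "2 * j + 1 \<le> length s" for j
    proof -
      have "nth_code (list_encode s) 0 = s ! 0"
        by (rule nth_code_encode) (use that in linarith)
      then show ?thesis using that unfolding B_def mapB[OF that] by auto
    qed
    moreover have "2 * j \<le> length s \<Longrightarrow> j \<le> length s" for j by simp
    ultimately show ?thesis unfolding G_def len_encode
      by (smt (verit, best) add_leD1)
  qed
  \<comment> \<open>A constraint in force reads only entries already played, so later moves cannot
    change it. Hence prefixes of legal positions are legal.\<close>
  have coh: "A (s @ t) j \<longleftrightarrow> A s j" if "2 * j \<le> length s" for s t j
  proof (cases "j = 0")
    case False
    with that have eqs: "map (\<lambda>k. (s @ t) ! (2 * k + 1)) [0..<j] = map (\<lambda>k. s ! (2 * k + 1)) [0..<j]"
      "(s @ t) ! 0 = s ! 0"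
      using that by (auto simp: nth_append)
    show ?thesis unfolding A_def eqs using that by (auto simp: nth_append)
  qed (simp add: A_def)
  have coh': "B (s @ t) j \<longleftrightarrow> B s j" if "2 * j + 1 \<le> length s" for s t j
  proof -
    have eqs: "map (\<lambda>k. (s @ t) ! (2 * k + 2)) [0..<j] = map (\<lambda>k. s ! (2 * k + 2)) [0..<j]"
      "(s @ t) ! 0 = s ! 0"
      using that by (auto simp: nth_append)
    show ?thesis unfolding B_def eqs using that by (auto simp: nth_append)
  qed
  have pre: "G s" if "G (s @ [x])" for s x
    unfolding G
  proof (intro allI conjI impI)
    fix j
    show "A s j" if "2 * j \<le> length s"
      using \<open>G (s @ [x])\<close> coh[OF that] that unfolding G by (metis length_append trans_le_add1)
    show "B s j" if "2 * j + 1 \<le> length s"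
      using \<open>G (s @ [x])\<close> coh'[OF that] that unfolding G by (metis length_append trans_le_add1)
  qed
  have pathI: "F \<in> K" if path: "\<And>j. \<exists>s. \<exists>l::nat\<Rightarrow>nat. D (list_encode (map (\<lambda>k. s ! l k) [0..<j])) \<and> (\<forall>k<j. s ! l k = F k)" for F
  proof -
    have "D (initial F j)" for j
    proof -
      obtain s and l :: "nat \<Rightarrow> nat" where "D (list_encode (map (\<lambda>k. s ! l k) [0..<j]))" "\<forall>k<j. s ! l k = F k"
        using path by blast
      moreover from this(2) have "map (\<lambda>k. s ! l k) [0..<j] = map F [0..<j]" by simp
      ultimately show ?thesis by (simp add: initial_def)
    qed
    then show ?thesis by (simp add: D(2))
  qed
  have wf: "wf {(s @ [x], s) | s x. G (s @ [x])}"
    unfolding wf_iff_no_infinite_down_chain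
  proof
    assume "\<exists>f. \<forall>n. (f (Suc n), f n) \<in> {(s @ [x], s) | s x. G (s @ [x])}"
    then obtain f where f: "\<And>n. \<exists>x. f (Suc n) = f n @ [x]" and Gf: "\<And>n. G (f (Suc n))"
      by (smt (verit) Pair_inject mem_Collect_eq)
    have len: "length (f n) = length (f 0) + n" for n
    proof (induction n)
      case (Suc n)
      then show ?case using f[of n] by auto
    qed simp
    have mono: "f (n + d) ! k = f n ! k" if "k < length (f n)" for n d k
    proof (induction d)
      case (Suc d)
      then show ?case using f[of "n + d"] len[of "n + d"] len[of n] that by (auto simp: nth_append)
    qed simp
    \<comment> \<open>\<open>h\<close> is the infinite play, the common extension of all positions
      \<open>f n\<close>.\<close>
    define h where "h k = f (Suc k) ! k" for k
    have h: "f n ! k = h k" if "k < length (f n)" for n k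
      using mono[of k n "Suc k"] mono[of k "Suc k" n] len[of "Suc k"] that
      unfolding h_def by (simp add: add.commute)
    have AB: "A (f n) j" "B (f n) j" if jn: "2 * j < n" for n j
    proof -
      obtain n' where "n = Suc n'" using jn by (cases n) auto
      then have "G (f n)" using Gf by simp
      then show "A (f n) j" "B (f n) j" using jn len[of n] unfolding G by auto
    qed
    define a b where "a k = h (2 * k + 1)" and "b k = h (2 * k + 2)" for k
    have "a \<in> K"
    proof (rule pathI)
      fix j
      have "D (list_encode (map (\<lambda>k. f (2 * j + 1) ! (2 * k + 1)) [0..<j]))"
        using AB(1)[of j "2 * j + 1"] by (simp add: A_def)
      moreover have "\<forall>k<j. f (2 * j + 1) ! (2 * k + 1) = a k"
        using len[of "2 * j + 1"] by (auto intro!: h simp: a_def)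
      ultimately show "\<exists>s l. D (list_encode (map (\<lambda>k. s ! l k) [0..<j])) \<and> (\<forall>k<j. s ! l k = a k)"
        by (intro exI[of _ "f (2 * j + 1)"] exI[of _ "\<lambda>k. 2 * k + 1"] conjI)
    qed
    moreover have "b \<in> K"
    proof (rule pathI)
      fix j
      have "D (list_encode (map (\<lambda>k. f (2 * j + 1) ! (2 * k + 2)) [0..<j]))"
        using AB(2)[of j "2 * j + 1"] by (simp add: B_def)
      moreover have "\<forall>k<j. f (2 * j + 1) ! (2 * k + 2) = b k"
        using len[of "2 * j + 1"] by (auto intro!: h simp: b_def)
      ultimately show "\<exists>s l. D (list_encode (map (\<lambda>k. s ! l k) [0..<j])) \<and> (\<forall>k<j. s ! l k = b k)"
        by (intro exI[of _ "f (2 * j + 1)"] exI[of _ "\<lambda>k. 2 * k + 2"] conjI)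
    qed
    moreover define c where "c = pair i (h 0)"
    have "a c \<noteq> 0 \<and> b c = 0"
    proof -
      \<comment> \<open>At this length both players' constraints on their values at place
        \<open>c\<close> are in force.\<close>
      let ?n = "2 * Suc c + 1"
      have "f ?n ! 0 = h 0" "f ?n ! (2 * c + 1) = a c" "f ?n ! (2 * c + 2) = b c"
        using len[of ?n] by (auto intro!: h simp: a_def b_def)
      then show ?thesis using AB[of "Suc c" ?n] by (simp add: A_def B_def c_def)
    qed
    then have "h 0 \<in> row a i" "h 0 \<notin> row b i" by (simp_all add: row_def c_def)
    ultimately show False using X[of a] X[of b] by simp
  qed
  obtain F where "F \<in> K" using \<open>K \<noteq> {}\<close> by blast
  have D_F: "D (initial F j)" for j using \<open>F \<in> K\<close> by (simp add: D(2))
  have F_c: "F (pair i m) \<noteq> 0 \<longleftrightarrow> m \<in> X" for m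
    using X[OF \<open>F \<in> K\<close>] by (auto simp: row_def)
  have start: "G [m]" for m
    using D_F[of 0] by (auto simp: G A_def B_def initial_def)
  obtain W where W: "\<And>s. G s \<Longrightarrow> W s \<longleftrightarrow> (\<exists>x. G (s @ [x]) \<and> \<not> W (s @ [x]))"
    and HYP: "{m. W [m]} \<in> HYP"
    by (rule HYP_game[OF \<open>odec (\<lambda>A s. G (list_decode s))\<close> _ wf start]) (erule pre, rule that)
  \<comment> \<open>For \<open>m\<close> in \<open>X\<close>, copying \<open>F\<close> is always
    legal for the first player, who moves at odd lengths. As no play is infinite, it is the second
    player who gets stuck.\<close>
  have inX: "if even (length s) then \<not> W s else W s"
    if "G s" "s \<noteq> []" "s ! 0 = m" "m \<in> X" "\<forall>k. 2 * k + 1 < length s \<longrightarrow> s ! (2 * k + 1) = F k" for s m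
    using wf that
  proof (induction s rule: wf_induct_rule)
    case (less s)
    show ?case
    proof (cases "even (length s)")
      case True
      have "W (s @ [x])" if "G (s @ [x])" for x
        using less.IH[of "s @ [x]"] less.prems that True by (auto simp: nth_append)
      then show ?thesis using W[OF less.prems(1)] True by auto
    next
      case False
      then obtain j where j: "length s = 2 * j + 1" by (elim oddE)
      let ?t = "s @ [F j]"
      have t: "?t ! (2 * k + 1) = F k" if "k \<le> j" for k
        using that less.prems(5) j by (cases "k = j") (auto simp: nth_append)
      have "A ?t l" if "2 * l \<le> length ?t" for l
      proof -
        have eqs: "map (\<lambda>k. ?t ! (2 * k + 1)) [0..<l] = map F [0..<l]"
          using that j t by (intro map_cong refl) auto
        have hd: "?t ! 0 = m" using less.prems by (simp add: nth_append)
        show ?thesis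
          unfolding A_def eqs hd
          using D_F[of l] F_c[of m] less.prems(4) that j t[of "pair i m"] by (simp add: initial_def)
      qed
      moreover have "B ?t l" if "2 * l + 1 \<le> length ?t" for l
        using that j coh'[of l s] less.prems(1) by (auto simp: G)
      ultimately have "G ?t" by (simp add: G)
      moreover have "\<not> W ?t"
      proof -
        have "\<forall>k. 2 * k + 1 < length ?t \<longrightarrow> ?t ! (2 * k + 1) = F k" using t j by auto
        then show ?thesis
          using less.IH[of ?t] less.prems \<open>G ?t\<close> j by (auto simp: nth_append)
      qed
      ultimately show ?thesis using W[OF less.prems(1)] False by auto
    qed
  qed
  \<comment> \<open>The mirror image: outside \<open>X\<close> the second player, moving at positive
    even lengths, can always copy \<open>F\<close>.\<close>
  have notinX: "if even (length s) then W s else \<not> W s"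
    if "G s" "s \<noteq> []" "s ! 0 = m" "m \<notin> X" "\<forall>k. 2 * k + 2 < length s \<longrightarrow> s ! (2 * k + 2) = F k" for s m
    using wf that
  proof (induction s rule: wf_induct_rule)
    case (less s)
    show ?case
    proof (cases "even (length s)")
      case False
      have "W (s @ [x])" if "G (s @ [x])" for x
      proof -
        have "(s @ [x]) ! (2 * k + 2) = F k" if "2 * k + 2 < length (s @ [x])" for k
        proof -
          have "2 * k + 2 \<noteq> length s" using False by (metis even_add dvd_triv_left dvd_refl)
          then show ?thesis using that less.prems by (simp add: nth_append)
        qed
        then show ?thesis
          using less.IH[of "s @ [x]"] less.prems that False by (auto simp: nth_append)
      qed
      then show ?thesis using W[OF less.prems(1)] False by auto
    next
      case True
      moreover have "length s \<noteq> 0" using less.prems by simp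
      ultimately obtain j where j: "length s = 2 * j + 2"
        by (metis add_2_eq_Suc' dvdE mult_Suc_right not0_implies_Suc mult_0_right add.commute)
      let ?t = "s @ [F j]"
      have t: "?t ! (2 * k + 2) = F k" if "k \<le> j" for k
        using that less.prems(5) j by (cases "k = j") (auto simp: nth_append)
      have "B ?t l" if "2 * l + 1 \<le> length ?t" for l
      proof -
        have eqs: "map (\<lambda>k. ?t ! (2 * k + 2)) [0..<l] = map F [0..<l]"
          using that j t by (intro map_cong refl) auto
        have hd: "?t ! 0 = m" using less.prems by (simp add: nth_append)
        show ?thesis
          unfolding B_def eqs hd
          using D_F[of l] F_c[of m] less.prems(4) that j t[of "pair i m"] by (simp add: initial_def)
      qed
      moreover have "A ?t l" if "2 * l \<le> length ?t" for l
      proof -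
        \<comment> \<open>The length of \<open>?t\<close> is odd, so the first player's constraints
          on \<open>?t\<close> are those already met by \<open>s\<close>.\<close>
        have "2 * l \<le> length s" using that j by simp presburger
        then show ?thesis using coh[of l s] less.prems(1) by (simp add: G)
      qed
      ultimately have "G ?t" by (simp add: G)
      moreover have "\<not> W ?t"
      proof -
        have "\<forall>k. 2 * k + 2 < length ?t \<longrightarrow> ?t ! (2 * k + 2) = F k" using t j by auto
        then show ?thesis
          using less.IH[of ?t] less.prems \<open>G ?t\<close> j by (auto simp: nth_append)
      qed
      ultimately show ?thesis using W[OF less.prems(1)] True by auto
    qed
  qed
  have "X = {m. W [m]}"
    using inX[OF start] notinX[OF start] by fastforce
  then show ?thesis using HYP by simp
qed

subsection \<open>Arithmetical formulas\<close>

instance trm :: countable by countable_datatype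
instance fm :: countable by countable_datatype

lemma sat_cong:
  assumes "\<And>i. i \<in> free_num \<phi> \<Longrightarrow> e i = e' i" "\<And>i. i \<in> free_set \<phi> \<Longrightarrow> E i = E' i"
  shows "sat M e E \<phi> \<longleftrightarrow> sat M e' E' \<phi>"
proof -
  have trm: "trm_val e t = trm_val e' t" if "\<And>i. i \<in> trm_vars t \<Longrightarrow> e i = e' i" for e e' t
    using that by (induction t) auto
  show ?thesis
    using assms
  proof (induction \<phi> arbitrary: e e' E E')
    case (Eq s t)
    then show ?case using trm[of s e e'] trm[of t e e'] by simp
  next
    case (Less s t)
    then show ?case using trm[of s e e'] trm[of t e e'] by simp
  next
    case (Mem t i)
    then show ?case using trm[of t e e'] by simp
  next
    case (Neg \<phi>)
    have "sat M e E \<phi> = sat M e' E' \<phi>" by (rule Neg.IH) (use Neg.prems in auto)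
    then show ?case by simp
  next
    case (Conj \<phi> \<psi>)
    have "sat M e E \<phi> = sat M e' E' \<phi>" by (rule Conj.IH(1)) (use Conj.prems in auto)
    moreover have "sat M e E \<psi> = sat M e' E' \<psi>" by (rule Conj.IH(2)) (use Conj.prems in auto)
    ultimately show ?case by simp
  next
    case (ExN i \<phi>)
    have "sat M (e(i := n)) E \<phi> = sat M (e'(i := n)) E' \<phi>" for n
      by (rule ExN.IH) (use ExN.prems in auto)
    then show ?case by simp
  next
    case (ExS i \<phi>)
    have "sat M e (E(i := X)) \<phi> = sat M e' (E'(i := X)) \<phi>" for X
      by (rule ExS.IH) (use ExS.prems in auto)
    then show ?case by simp
  qed
qed

lemma sat_arithmetical: "arithmetical \<phi> \<Longrightarrow> sat M e E \<phi> \<longleftrightarrow> sat N e E \<phi>"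
  by (induction \<phi> arbitrary: e E) auto

lemma finite_free: "finite (free_num \<phi>)" "finite (free_set \<phi>)"
proof -
  have "finite (trm_vars t)" for t by (induction t) auto
  then show "finite (free_num \<phi>)" by (induction \<phi>) auto
  show "finite (free_set \<phi>)" by (induction \<phi>) auto
qed

lemma crec_fun_upd: "crec f \<Longrightarrow> crec (f(a := b))"
  unfolding fun_upd_def by (intro orec_intros)

text \<open>A formula reads only finitely many variables, so any assignment can be exchanged for a
  recursive one with the same values on them.\<close>

lemma crec_finite_support: "finite A \<Longrightarrow> crec (\<lambda>i. if i \<in> A then f i else 0)"
proof (induction A rule: finite_induct)
  case (insert a A)
  have "(\<lambda>i. if i \<in> insert a A then f i else 0) = (\<lambda>i. if i \<in> A then f i else 0)(a := f a)"
    by auto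
  then show ?case using crec_fun_upd[OF insert.IH] by simp
qed (simp add: orec_const)

lemma countable_crec: "countable {f. crec f}"
proof (rule countable_subset)
  show "countable (range (\<lambda>r n. THE y. computes {} r [n] y))"
    using countableI[of code UNIV] by (auto simp: inj_def dest: code_inject)
  show "{f. crec f} \<subseteq> range (\<lambda>r n. THE y. computes {} r [n] y)"
  proof
    fix f assume "f \<in> {f. crec f}"
    then obtain r where "\<And>n. computes {} r [n] (f n)" unfolding orec_def by blast
    then have "f = (\<lambda>n. THE y. computes {} r [n] y)"
      by (intro ext) (metis computes_deterministic the_equality)
    then show "f \<in> range (\<lambda>r n. THE y. computes {} r [n] y)" by blast
  qed
qed

section \<open>Sigma-1-1 normal form of arithmetical formulas\<close>

definition nums :: "(nat \<Rightarrow> nat) \<Rightarrow> nat \<Rightarrow> nat" where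
  "nums G i = G (2 * i)"

definition sets :: "(nat \<Rightarrow> nat) \<Rightarrow> nat \<Rightarrow> nat set" where
  "sets G i = {m. G (Suc (2 * pair i m)) \<noteq> 0}"

text \<open>Kleene normal form of a Sigma-1-1 predicate: a function witness \<open>w\<close> and a
  closed matrix. \<open>w\<close> and \<open>G\<close> are zipped because a \<open>cdec\<close>
  predicate reads one function.\<close>

definition Sig :: "((nat \<Rightarrow> nat) \<Rightarrow> bool) \<Rightarrow> bool" where
  "Sig R \<longleftrightarrow> (\<exists>P. cdec P \<and> (\<forall>G. R G \<longleftrightarrow> (\<exists>w. \<forall>k. P (\<lambda>n. pair (w n) (G n)) k)))"

lemma Sig_cdec:
  assumes "cdec (\<lambda>G x. B G)" shows "Sig B"
proof -
  have "cdec (\<lambda>f x. B (\<lambda>j. p2 (f j)))"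
    by (intro cdec_subst[OF assms _ ceff_id] ceff_intros)
  then show ?thesis
    unfolding Sig_def by (intro exI[of _ "\<lambda>f x. B (\<lambda>j. p2 (f j))"]) simp
qed

lemma Sig_conj:
  assumes "Sig R" "Sig S" shows "Sig (\<lambda>G. R G \<and> S G)"
proof -
  obtain P Q where P: "cdec P" "\<And>G. R G \<longleftrightarrow> (\<exists>w. \<forall>k. P (\<lambda>n. pair (w n) (G n)) k)"
    and Q: "cdec Q" "\<And>G. S G \<longleftrightarrow> (\<exists>w. \<forall>k. Q (\<lambda>n. pair (w n) (G n)) k)"
    using assms unfolding Sig_def by blast
  let ?P = "\<lambda>f k. P (\<lambda>j. pair (p1 (p1 (f j))) (p2 (f j))) k \<and> Q (\<lambda>j. pair (p2 (p1 (f j))) (p2 (f j))) k"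
  have "cdec ?P"
    by (intro cdec_conj cdec_subst[OF P(1)] cdec_subst[OF Q(1)] ceff_intros)
  moreover have "R G \<and> S G \<longleftrightarrow> (\<exists>w. \<forall>k. ?P (\<lambda>n. pair (w n) (G n)) k)" for G
  proof
    assume "R G \<and> S G"
    then obtain w v where "\<forall>k. P (\<lambda>n. pair (w n) (G n)) k" "\<forall>k. Q (\<lambda>n. pair (v n) (G n)) k"
      using P(2) Q(2) by blast
    then show "\<exists>w. \<forall>k. ?P (\<lambda>n. pair (w n) (G n)) k"
      by (intro exI[of _ "\<lambda>n. pair (w n) (v n)"]) simp
  next
    assume "\<exists>w. \<forall>k. ?P (\<lambda>n. pair (w n) (G n)) k"
    then obtain w where w: "\<forall>k. ?P (\<lambda>n. pair (w n) (G n)) k" ..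
    have "R G" unfolding P(2) using w by (intro exI[of _ "\<lambda>n. p1 (w n)"] allI) simp
    moreover have "S G" unfolding Q(2) using w by (intro exI[of _ "\<lambda>n. p2 (w n)"] allI) simp
    ultimately show "R G \<and> S G" ..
  qed
  ultimately show ?thesis unfolding Sig_def by (intro exI[of _ ?P]) blast
qed

lemma Sig_disj:
  assumes "Sig R" "Sig S" shows "Sig (\<lambda>G. R G \<or> S G)"
proof -
  obtain P Q where P: "cdec P" "\<And>G. R G \<longleftrightarrow> (\<exists>w. \<forall>k. P (\<lambda>n. pair (w n) (G n)) k)"
    and Q: "cdec Q" "\<And>G. S G \<longleftrightarrow> (\<exists>w. \<forall>k. Q (\<lambda>n. pair (w n) (G n)) k)"
    using assms unfolding Sig_def by blast
  \<comment> \<open>The first component of \<open>w 0\<close> tells which disjunct the second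
    components of \<open>w\<close> are a witness for.\<close>
  let ?P = "\<lambda>f k. p1 (p1 (f 0)) = 0 \<and> P (\<lambda>j. pair (p2 (p1 (f j))) (p2 (f j))) k \<or>
    \<not> p1 (p1 (f 0)) = 0 \<and> Q (\<lambda>j. pair (p2 (p1 (f j))) (p2 (f j))) k"
  have "cdec ?P"
    by (intro cdec_disj cdec_conj cdec_subst[OF P(1)] cdec_subst[OF Q(1)] ceff_intros)
  moreover have "R G \<or> S G \<longleftrightarrow> (\<exists>w. \<forall>k. ?P (\<lambda>n. pair (w n) (G n)) k)" for G
  proof
    assume "R G \<or> S G"
    then show "\<exists>w. \<forall>k. ?P (\<lambda>n. pair (w n) (G n)) k"
    proof
      assume "R G"
      then obtain w where "\<forall>k. P (\<lambda>n. pair (w n) (G n)) k" using P(2) by blast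
      then show ?thesis by (intro exI[of _ "\<lambda>n. pair 0 (w n)"]) simp
    next
      assume "S G"
      then obtain w where "\<forall>k. Q (\<lambda>n. pair (w n) (G n)) k" using Q(2) by blast
      then show ?thesis by (intro exI[of _ "\<lambda>n. pair 1 (w n)"]) simp
    qed
  next
    assume "\<exists>w. \<forall>k. ?P (\<lambda>n. pair (w n) (G n)) k"
    then obtain w where w: "\<forall>k. ?P (\<lambda>n. pair (w n) (G n)) k" ..
    show "R G \<or> S G"
    proof (cases "p1 (w 0) = 0")
      case True
      then have "R G" unfolding P(2) using w by (intro exI[of _ "\<lambda>n. p2 (w n)"] allI) simp
      then show ?thesis ..
    next
      case False
      then have "S G" unfolding Q(2) using w by (intro exI[of _ "\<lambda>n. p2 (w n)"] allI) simp
      then show ?thesis ..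
    qed
  qed
  ultimately show ?thesis unfolding Sig_def by (intro exI[of _ ?P]) blast
qed

lemma Sig_ex:
  assumes "Sig R" shows "Sig (\<lambda>G. \<exists>n. R (G(a := n)))"
proof -
  obtain P where P: "cdec P" "\<And>G. R G \<longleftrightarrow> (\<exists>w. \<forall>k. P (\<lambda>n. pair (w n) (G n)) k)"
    using assms unfolding Sig_def by blast
  \<comment> \<open>The first component of \<open>w 0\<close> is the number \<open>n\<close>,
    inserted at place \<open>a\<close>; the second components are the witness for
    \<open>R\<close>.\<close>
  let ?P = "\<lambda>f k. P (\<lambda>j. pair (p2 (p1 (f j))) (if j = a then p1 (p1 (f 0)) else p2 (f j))) k"
  have "cdec ?P" by (intro cdec_subst[OF P(1)] ceff_intros)
  moreover have "(\<exists>n. R (G(a := n))) \<longleftrightarrow> (\<exists>w. \<forall>k. ?P (\<lambda>n. pair (w n) (G n)) k)" for G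
  proof
    assume "\<exists>n. R (G(a := n))"
    then obtain n w where "\<forall>k. P (\<lambda>j. pair (w j) ((G(a := n)) j)) k" using P(2) by blast
    then show "\<exists>w. \<forall>k. ?P (\<lambda>n. pair (w n) (G n)) k"
      by (intro exI[of _ "\<lambda>j. pair n (w j)"]) (simp add: fun_upd_def cong: if_cong)
  next
    assume "\<exists>w. \<forall>k. ?P (\<lambda>n. pair (w n) (G n)) k"
    then obtain w where "\<forall>k. ?P (\<lambda>n. pair (w n) (G n)) k" ..
    then have "R (G(a := p1 (w 0)))"
      unfolding P(2) by (intro exI[of _ "\<lambda>j. p2 (w j)"]) (simp add: fun_upd_def cong: if_cong)
    then show "\<exists>n. R (G(a := n))" ..
  qed
  ultimately show ?thesis unfolding Sig_def by (intro exI[of _ ?P]) blast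
qed

lemma Sig_all:
  assumes "Sig R" shows "Sig (\<lambda>G. \<forall>n. R (G(a := n)))"
proof -
  obtain P where P: "cdec P" "\<And>G. R G \<longleftrightarrow> (\<exists>w. \<forall>k. P (\<lambda>n. pair (w n) (G n)) k)"
    using assms unfolding Sig_def by blast
  \<comment> \<open>Witnesses for all \<open>n\<close>, picked by countable choice, are merged into
    one \<open>w\<close> by way of \<open>w (pair n j)\<close>; the universal variable packs
    \<open>n\<close> with the inner one.\<close>
  let ?P = "\<lambda>f k. P (\<lambda>j. pair (p1 (f (pair (p1 k) j))) (if j = a then p1 k else p2 (f j))) (p2 k)"
  have "cdec ?P" by (intro cdec_subst[OF P(1)] ceff_intros)
  moreover have "(\<forall>n. R (G(a := n))) \<longleftrightarrow> (\<exists>w. \<forall>k. ?P (\<lambda>n. pair (w n) (G n)) k)" for G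
  proof
    assume "\<forall>n. R (G(a := n))"
    then have "\<forall>n. \<exists>w. \<forall>k. P (\<lambda>j. pair (w j) ((G(a := n)) j)) k" using P(2) by blast
    then obtain W where "\<forall>n k. P (\<lambda>j. pair (W n j) ((G(a := n)) j)) k" by metis
    then show "\<exists>w. \<forall>k. ?P (\<lambda>n. pair (w n) (G n)) k"
      by (intro exI[of _ "\<lambda>z. W (p1 z) (p2 z)"]) (simp add: fun_upd_def cong: if_cong)
  next
    assume "\<exists>w. \<forall>k. ?P (\<lambda>n. pair (w n) (G n)) k"
    then obtain w where w: "\<And>k. ?P (\<lambda>n. pair (w n) (G n)) k" by blast
    have "P (\<lambda>j. pair (w (pair n j)) ((G(a := n)) j)) k" for n k
      using w[of "pair n k"] by (simp add: fun_upd_def cong: if_cong)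
    then show "\<forall>n. R (G(a := n))"
      unfolding P(2) by (intro allI exI[of _ "\<lambda>j. w (pair n j)" for n])
  qed
  ultimately show ?thesis unfolding Sig_def by (intro exI[of _ ?P]) blast
qed

lemma ceff_trm_val: "ceff (\<lambda>G x. trm_val (nums G) t)"
  by (induction t) (simp_all add: nums_def ceff_intros)

text \<open>With both sorts coded in one function, binding a number variable changes a single value
  of \<open>G\<close>, which is the shape of \<open>Sig_ex\<close> and
  \<open>Sig_all\<close>.\<close>

lemma nums_sets_upd:
  "(nums G)(i := n) = nums (G(2 * i := n))" "sets (G(2 * i := n)) = sets G"
proof -
  have "Suc (2 * a) \<noteq> 2 * i" for a by presburger
  then show "sets (G(2 * i := n)) = sets G" by (auto simp: sets_def fun_eq_iff)
qed (auto simp: nums_def)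

text \<open>Truth and falsity are treated together because \<open>Neg\<close> interchanges them,
  while \<open>Sig\<close> has no closure rule for complements.\<close>

lemma Sig_arithmetical:
  assumes "arithmetical \<phi>"
  shows "Sig (\<lambda>G. sat M (nums G) (sets G) \<phi>)" "Sig (\<lambda>G. \<not> sat M (nums G) (sets G) \<phi>)"
proof -
  have "Sig (\<lambda>G. sat M (nums G) (sets G) \<phi>) \<and> Sig (\<lambda>G. \<not> sat M (nums G) (sets G) \<phi>)"
    using assms
  proof (induction \<phi>)
    case (Eq s t)
    then show ?case by (auto intro!: Sig_cdec ceff_intros ceff_trm_val)
  next
    case (Less s t)
    then show ?case by (auto simp: not_less intro!: Sig_cdec ceff_intros ceff_trm_val
      intro: cdec_not[OF cdec_less, unfolded not_less])
  next
    case (Mem t i)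
    have "cdec (\<lambda>G x. \<not> G (Suc (2 * pair i (trm_val (nums G) t))) = 0)"
      by (intro ceff_intros ceff_trm_val)
    from Sig_cdec[OF this] Sig_cdec[OF cdec_not[OF this]] show ?case by (simp add: sets_def)
  next
    case (Neg \<phi>)
    then show ?case by simp
  next
    case (Conj \<phi> \<psi>)
    have "Sig (\<lambda>G. sat M (nums G) (sets G) \<phi> \<and> sat M (nums G) (sets G) \<psi>)"
      "Sig (\<lambda>G. \<not> sat M (nums G) (sets G) \<phi> \<or> \<not> sat M (nums G) (sets G) \<psi>)"
      by (intro Sig_conj Sig_disj; use Conj in auto)+
    then show ?case by (simp only: sat.simps de_Morgan_conj simp_thms)
  next
    case (ExN i \<phi>)
    then have "Sig (\<lambda>G. \<exists>n. sat M (nums (G(2 * i := n))) (sets (G(2 * i := n))) \<phi>)"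
      "Sig (\<lambda>G. \<forall>n. \<not> sat M (nums (G(2 * i := n))) (sets (G(2 * i := n))) \<phi>)"
      using Sig_ex[of "\<lambda>G. sat M (nums G) (sets G) \<phi>"]
        Sig_all[of "\<lambda>G. \<not> sat M (nums G) (sets G) \<phi>"] by auto
    then show ?case by (simp add: nums_sets_upd)
  next
    case (ExS i \<phi>)
    then show ?case by simp
  qed
  then show "Sig (\<lambda>G. sat M (nums G) (sets G) \<phi>)" "Sig (\<lambda>G. \<not> sat M (nums G) (sets G) \<phi>)"
    by auto
qed

subsection \<open>Forcing\<close>

definition supported :: "nat \<Rightarrow> (nat \<Rightarrow> nat) set \<Rightarrow> bool" where
  "supported N K \<longleftrightarrow>
    (\<forall>F F'. F \<in> K \<longrightarrow> (\<forall>i<N. \<forall>m. F (pair i m) = F' (pair i m)) \<longrightarrow> F' \<in> K)"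

definition cond :: "(nat \<Rightarrow> nat) set \<Rightarrow> bool" where
  "cond K \<longleftrightarrow> effclosed K \<and> K \<noteq> {} \<and> (\<exists>N. supported N K)"

lemma supported_mono: "supported N K \<Longrightarrow> N \<le> N' \<Longrightarrow> supported N' K"
  unfolding supported_def by (meson less_le_trans)

lemma cond_IntI:
  assumes "cond p" "effclosed K" "supported N K" "F \<in> p" "F \<in> K"
  shows "cond (p \<inter> K)"
proof -
  obtain N' where "supported N' p" using assms unfolding cond_def by blast
  then have "supported (max N N') p" "supported (max N N') K"
    using assms supported_mono by (auto intro: max.cobounded1 max.cobounded2)
  then have "supported (max N N') (p \<inter> K)" unfolding supported_def by blast
  then show ?thesis using assms effclosed_Int unfolding cond_def by blast
qed

lemma cond_UNIV: "cond UNIV"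
proof -
  have "effclosed UNIV"
    using effclosed_all[OF cdec_eq[OF ceff_id ceff_id]] by simp
  then show ?thesis by (auto simp: cond_def supported_def)
qed

text \<open>Set variables are assigned row indices, which are names for elements of the model to
  come. This is strong forcing: an existential formula is forced only through a named
  witness.\<close>

primrec forces :: "(nat \<Rightarrow> nat) set \<Rightarrow> (nat \<Rightarrow> nat) \<Rightarrow> (nat \<Rightarrow> nat) \<Rightarrow> fm \<Rightarrow> bool" where
  "forces p e s (Eq t u) \<longleftrightarrow> trm_val e t = trm_val e u"
| "forces p e s (Less t u) \<longleftrightarrow> trm_val e t < trm_val e u"
| "forces p e s (Mem t i) \<longleftrightarrow> (\<forall>F\<in>p. trm_val e t \<in> row F (s i))"
| "forces p e s (Neg \<phi>) \<longleftrightarrow> (\<forall>q. cond q \<longrightarrow> q \<subseteq> p \<longrightarrow> \<not> forces q e s \<phi>)"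
| "forces p e s (Conj \<phi> \<psi>) \<longleftrightarrow> forces p e s \<phi> \<and> forces p e s \<psi>"
| "forces p e s (ExN i \<phi>) \<longleftrightarrow> (\<exists>n. forces p (e(i := n)) s \<phi>)"
| "forces p e s (ExS i \<phi>) \<longleftrightarrow> (\<exists>n. forces p e (s(i := n)) \<phi>)"

lemma forces_mono: "forces p e s \<phi> \<Longrightarrow> q \<subseteq> p \<Longrightarrow> forces q e s \<phi>"
proof (induction \<phi> arbitrary: e s)
  case (Neg \<phi>)
  then show ?case by (metis forces.simps(4) order_trans)
qed auto

section \<open>Renaming of rows\<close>

definition permute :: "(nat \<Rightarrow> nat) \<Rightarrow> nat \<Rightarrow> nat" where
  "permute \<pi> z = pair (\<pi> (p1 z)) (p2 z)"

definition act :: "(nat \<Rightarrow> nat) \<Rightarrow> (nat \<Rightarrow> nat) set \<Rightarrow> (nat \<Rightarrow> nat) set" where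
  "act \<pi> p = {F. F \<circ> permute \<pi> \<in> p}"

context
  fixes \<pi> :: "nat \<Rightarrow> nat"
  assumes crec: "crec \<pi>" and involution: "\<And>i. \<pi> (\<pi> i) = i"
begin

lemma permute_permute: "permute \<pi> \<circ> permute \<pi> = id"
  by (auto simp: permute_def involution fun_eq_iff)

lemma act_act: "act \<pi> (act \<pi> p) = p"
  by (simp add: act_def comp_assoc permute_permute)

lemma act_mono: "p \<subseteq> q \<Longrightarrow> act \<pi> p \<subseteq> act \<pi> q"
  by (auto simp: act_def)

lemma row_permute: "row (F \<circ> permute \<pi>) i = row F (\<pi> i)"
  by (simp add: row_def permute_def)

lemma effclosed_act: "effclosed p \<Longrightarrow> effclosed (act \<pi> p)"
  unfolding act_def
proof (rule effclosed_vimage)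
  show "crec (permute \<pi>)"
    unfolding permute_def[abs_def] by (intro orec_intros orec_comp[OF crec])
qed

lemma supported_act:
  assumes "supported N p" shows "\<exists>N'. supported N' (act \<pi> p)"
proof -
  obtain N' where N': "\<pi> ` {..<N} \<subseteq> {..<N'}"
    using finite_nat_bounded[of "\<pi> ` {..<N}"] by auto
  have "supported N' (act \<pi> p)"
    unfolding supported_def act_def
  proof (intro allI impI CollectI)
    fix F F' assume F: "F \<in> {F. F \<circ> permute \<pi> \<in> p}" and eq: "\<forall>i<N'. \<forall>m. F (pair i m) = F' (pair i m)"
    have "(F \<circ> permute \<pi>) (pair i m) = (F' \<circ> permute \<pi>) (pair i m)" if "i < N" for i m
      using eq N' that by (auto simp: permute_def image_subset_iff)
    then show "F' \<circ> permute \<pi> \<in> p" using F assms unfolding supported_def by blast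
  qed
  then show ?thesis ..
qed

lemma cond_act:
  assumes "cond p" shows "cond (act \<pi> p)"
proof -
  obtain F where "F \<in> p" using assms unfolding cond_def by blast
  then have "F \<circ> permute \<pi> \<in> act \<pi> p"
    by (simp add: act_def comp_assoc permute_permute)
  then show ?thesis using assms effclosed_act supported_act unfolding cond_def by blast
qed

text \<open>The case of \<open>Neg\<close> is where the involution matters: a condition below
  \<open>act \<pi> p\<close> is moved back below \<open>p\<close> by the same
  \<open>\<pi>\<close>.\<close>

lemma forces_act: "forces p e s \<phi> \<Longrightarrow> forces (act \<pi> p) e (\<pi> \<circ> s) \<phi>"
proof (induction \<phi> arbitrary: p e s)
  case (Mem t i)
  have "trm_val e t \<in> row F (\<pi> (s i))" if "F \<circ> permute \<pi> \<in> p" for F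
    using Mem that row_permute[of F "s i"] by auto
  then show ?case by (simp add: act_def)
next
  case (Neg \<phi>)
  show ?case unfolding forces.simps
  proof (intro allI impI notI)
    fix q assume q: "cond q" "q \<subseteq> act \<pi> p" "forces q e (\<pi> \<circ> s) \<phi>"
    have eq: "\<pi> \<circ> (\<pi> \<circ> s) = s" by (simp add: fun_eq_iff involution)
    have "forces (act \<pi> q) e s \<phi>" using Neg.IH[OF q(3)] unfolding eq .
    moreover have "act \<pi> q \<subseteq> p" using act_mono[OF q(2)] by (simp add: act_act)
    ultimately show False using Neg.prems cond_act[OF q(1)] by simp
  qed
next
  case (ExS i \<phi>)
  then obtain n where "forces p e (s(i := n)) \<phi>" by auto
  then have "forces (act \<pi> p) e ((\<pi> \<circ> s)(i := \<pi> n)) \<phi>"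
    using ExS.IH by (metis fun_upd_comp)
  then show ?case unfolding forces.simps by blast
qed auto

end

section \<open>Generic sequences and their points\<close>

definition dense :: "(nat \<Rightarrow> nat) set set \<Rightarrow> bool" where
  "dense D \<longleftrightarrow> (\<forall>p. cond p \<longrightarrow> (\<exists>q\<in>D. cond q \<and> q \<subseteq> p))"

lemma generic_sequence:
  assumes "countable \<D>" "\<And>D. D \<in> \<D> \<Longrightarrow> dense D"
  obtains P where "\<And>n::nat. cond (P n)" "\<And>m n. m \<le> n \<Longrightarrow> P n \<subseteq> P m" "\<And>D. D \<in> \<D> \<Longrightarrow> \<exists>n. P n \<in> D"
proof -
  \<comment> \<open>Adding the trivially dense \<open>UNIV\<close> makes the family nonempty, so
    that \<open>from_nat_into\<close> enumerates it.\<close>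
  let ?D = "\<lambda>n. from_nat_into (insert UNIV \<D>) n"
  have dense: "dense (?D n)" for n
    using from_nat_into[of "insert UNIV \<D>" n] assms(2) by (auto simp: dense_def)
  have "\<exists>P. \<forall>n. cond (P n) \<and> (P (Suc n) \<subseteq> P n \<and> P (Suc n) \<in> ?D n)"
  proof (rule dependent_nat_choice)
    show "\<exists>p. cond p" using cond_UNIV by blast
    show "\<exists>q. cond q \<and> (q \<subseteq> p \<and> q \<in> ?D n)" if "cond p" for p n
      using dense[of n] that unfolding dense_def by blast
  qed
  then obtain P where P: "\<And>n. cond (P n)" "\<And>n. P (Suc n) \<subseteq> P n" "\<And>n. P (Suc n) \<in> ?D n" by blast
  have "\<exists>n. P n \<in> D" if "D \<in> \<D>" for D
    using P(3) from_nat_into_surj[of "insert UNIV \<D>" D] assms(1) that by (metis countable_insert insertI2)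
  then show ?thesis using that[of P] P(1) lift_Suc_antimono_le[of P] P(2) by blast
qed

definition decides :: "nat \<Rightarrow> (nat \<Rightarrow> nat) set set" where
  "decides c = {p. \<exists>v. \<forall>F\<in>p. F c = v}"

lemma dense_decides: "dense (decides c)"
  unfolding dense_def
proof (intro allI impI)
  fix p assume p: "cond p"
  then obtain F where F: "F \<in> p" unfolding cond_def by blast
  \<comment> \<open>The quantifier over \<open>k\<close> is a dummy that gives the set the shape of
    \<open>effclosed_all\<close>.\<close>
  have "effclosed {F'. \<forall>k::nat. F' c = F c}"
    by (intro effclosed_all ceff_intros)
  moreover have "supported (Suc (p1 c)) {F'. \<forall>k::nat. F' c = F c}"
    unfolding supported_def using prod.collapse[of "prod_decode c"]
    by (metis (mono_tags, lifting) lessI mem_Collect_eq prod_decode_inverse)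
  ultimately have "cond (p \<inter> {F'. \<forall>k::nat. F' c = F c})"
    using cond_IntI[OF p _ _ F] by simp
  then show "\<exists>q\<in>decides c. cond q \<and> q \<subseteq> p" by (intro bexI) (auto simp: decides_def)
qed

text \<open>In place of compactness, the sequence decides every value of the point, and closedness
  puts the resulting limit into each \<open>P n\<close>.\<close>

lemma generic_point:
  assumes "\<And>n::nat. cond (P n)" "\<And>m n. m \<le> n \<Longrightarrow> P n \<subseteq> P m" "\<And>c. \<exists>n. P n \<in> decides c"
  obtains g where "\<And>n. g \<in> P n"
proof -
  have "\<forall>c. \<exists>v n. \<forall>F\<in>P n. F c = v" using assms(3) unfolding decides_def by blast
  then obtain g N where g: "\<And>c F. F \<in> P (N c) \<Longrightarrow> F c = g c" by metis
  have "g \<in> P n" for n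
  proof (rule effclosed_limit)
    show "effclosed (P n)" using assms(1) unfolding cond_def by blast
    fix k
    define m where "m = Max (insert n (N ` {..<k}))"
    obtain F where F: "F \<in> P m" using assms(1) unfolding cond_def by blast
    have "n \<le> m" "c < k \<Longrightarrow> N c \<le> m" for c unfolding m_def by auto
    then have "F \<in> P n" "c < k \<Longrightarrow> F \<in> P (N c)" for c using F assms(2) by blast+
    then show "\<exists>F\<in>P n. \<forall>c<k. F c = g c" using g by blast
  qed
  then show ?thesis using that by blast
qed

section \<open>Truth in the generic model\<close>

definition settles :: "(nat \<Rightarrow> nat) \<Rightarrow> (nat \<Rightarrow> nat) \<Rightarrow> fm \<Rightarrow> (nat \<Rightarrow> nat) set set" where
  "settles e s \<phi> = {p. forces p e s \<phi> \<or> forces p e s (Neg \<phi>)}"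

lemma dense_settles: "dense (settles e s \<phi>)"
  unfolding dense_def settles_def by auto

text \<open>Only countably many dense sets can be met, so assignments are restricted to recursive
  ones. Recursiveness also keeps the sets in \<open>dense_witnesses\<close> effective, and the
  finite range in \<open>set_env\<close> leaves rows without a name.\<close>

definition num_env :: "(nat \<Rightarrow> nat) set" where "num_env = {e. crec e}"

definition set_env :: "(nat \<Rightarrow> nat) set" where "set_env = {s. crec s \<and> finite (range s)}"

lemma num_env_upd: "e \<in> num_env \<Longrightarrow> e(i := n) \<in> num_env"
  unfolding num_env_def using crec_fun_upd by simp

lemma set_env_upd: "s \<in> set_env \<Longrightarrow> s(i := n) \<in> set_env"
proof -
  assume "s \<in> set_env"
  moreover have "range (s(i := n)) \<subseteq> insert n (range s)" by auto
  ultimately show ?thesis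
    unfolding set_env_def using crec_fun_upd by (simp add: finite_subset)
qed

lemma const_env: "(\<lambda>_. c) \<in> num_env" "(\<lambda>_. c) \<in> set_env"
  by (simp_all add: num_env_def set_env_def orec_const)

lemma countable_env: "countable num_env" "countable set_env"
  using countable_crec by (auto simp: num_env_def set_env_def intro: countable_subset[OF _ countable_crec])

text \<open>Membership is fixed by \<open>decides\<close>. Negation needs \<open>settles\<close>,
  together with a common extension for consistency. Set quantifiers match because every element of
  the model is a named row.\<close>

lemma truth:
  assumes "\<And>n::nat. cond (P n)" "\<And>m n. m \<le> n \<Longrightarrow> P n \<subseteq> P m" "\<And>c. \<exists>n. P n \<in> decides c"
    and g: "\<And>n. g \<in> P n"
    and settles: "\<And>e s \<phi>. e \<in> num_env \<Longrightarrow> s \<in> set_env \<Longrightarrow> \<exists>n. P n \<in> settles e s \<phi>"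
  shows "e \<in> num_env \<Longrightarrow> s \<in> set_env \<Longrightarrow>
    sat (range (row g)) e (\<lambda>j. row g (s j)) \<phi> \<longleftrightarrow> (\<exists>n. forces (P n) e s \<phi>)"
proof (induction \<phi> arbitrary: e s)
  case (Mem t i)
  obtain n v where "\<forall>F\<in>P n. F (pair (s i) (trm_val e t)) = v"
    using assms(3) unfolding decides_def by blast
  moreover from this g[of n] have "v = g (pair (s i) (trm_val e t))" by simp
  ultimately show ?case using g by (auto simp: row_def intro!: exI[of _ n])
next
  case (Neg \<phi>)
  have "\<not> (forces (P m) e s \<phi> \<and> forces (P n) e s (Neg \<phi>))" for m n
  proof
    assume "forces (P m) e s \<phi> \<and> forces (P n) e s (Neg \<phi>)"
    moreover have "P (max m n) \<subseteq> P m" "P (max m n) \<subseteq> P n" by (simp_all add: assms(2))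
    ultimately show False using assms(1) forces_mono by (metis forces.simps(4))
  qed
  moreover obtain n where "forces (P n) e s \<phi> \<or> forces (P n) e s (Neg \<phi>)"
    using settles[OF Neg.prems] unfolding settles_def by blast
  ultimately show ?case using Neg.IH[OF Neg.prems] by (metis sat.simps(4))
next
  case (Conj \<phi> \<psi>)
  have "\<exists>k. forces (P k) e s (Conj \<phi> \<psi>)" if "forces (P m) e s \<phi>" "forces (P n) e s \<psi>" for m n
  proof -
    have "P (max m n) \<subseteq> P m" "P (max m n) \<subseteq> P n" by (simp_all add: assms(2))
    then show ?thesis using that forces_mono by (metis forces.simps(5))
  qed
  then show ?case using Conj.IH[OF Conj.prems] by auto
next
  case (ExN i \<phi>)
  have "sat (range (row g)) (e(i := n)) (\<lambda>j. row g (s j)) \<phi> \<longleftrightarrow>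
      (\<exists>k. forces (P k) (e(i := n)) s \<phi>)" for n
    by (rule ExN.IH[OF num_env_upd[OF ExN.prems(1)] ExN.prems(2)])
  then show ?case unfolding sat.simps forces.simps by blast
next
  case (ExS i \<phi>)
  have "(\<lambda>j. row g (s j))(i := row g n) = (\<lambda>j. row g ((s(i := n)) j))" for n
    by (simp add: fun_eq_iff)
  then have "sat (range (row g)) e ((\<lambda>j. row g (s j))(i := row g n)) \<phi> \<longleftrightarrow>
      (\<exists>k. forces (P k) e (s(i := n)) \<phi>)" for n
    using ExS.IH[OF ExS.prems(1) set_env_upd[OF ExS.prems(2)], of i n] by (simp only:)
  then show ?case unfolding sat.simps forces.simps by blast
qed auto

text \<open>Both alternatives concern actual truth at all points of the condition, hence at the
  generic point, so full second order truth is compared with the model without passing through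
  forcing.\<close>

definition witnesses :: "(nat \<Rightarrow> nat) \<Rightarrow> (nat \<Rightarrow> nat) \<Rightarrow> nat \<Rightarrow> fm \<Rightarrow> (nat \<Rightarrow> nat) set set" where
  "witnesses e s i \<theta> = {p. (\<forall>F\<in>p. \<not> sat UNIV e (\<lambda>j. row F (s j)) (ExS i \<theta>)) \<or>
    (\<exists>n. \<forall>F\<in>p. sat UNIV e ((\<lambda>j. row F (s j))(i := row F n)) \<theta>)}"

text \<open>Two fresh rows receive the witnessing set and a witness for its arithmetical property, which
  makes the property hold on a closed set.\<close>

lemma dense_witnesses:
  assumes "arithmetical \<theta>" and e: "e \<in> num_env" and s: "s \<in> set_env"
  shows "dense (witnesses e s i \<theta>)"
  unfolding dense_def
proof (intro allI impI)
  fix p assume p: "cond p"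
  show "\<exists>q\<in>witnesses e s i \<theta>. cond q \<and> q \<subseteq> p"
  proof (cases "\<forall>F\<in>p. \<not> sat UNIV e (\<lambda>j. row F (s j)) (ExS i \<theta>)")
    case True
    then show ?thesis using p by (auto simp: witnesses_def)
  next
    case False
    then obtain F Y where F: "F \<in> p" and Y: "sat UNIV e ((\<lambda>j. row F (s j))(i := Y)) \<theta>" by auto
    obtain N1 where N1: "supported N1 p" using p unfolding cond_def by blast
    obtain N2 where N2: "range s \<subseteq> {..<N2}"
      using s finite_nat_bounded[of "range s"] unfolding set_env_def by auto
    \<comment> \<open>Row \<open>n\<close> lies beyond the support of \<open>p\<close> and beyond
      every row named by \<open>s\<close>. It will hold \<open>Y\<close>, and row
      \<open>Suc n\<close> the function witness.\<close>
    define n where "n = max N1 N2"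
    define s' where "s' = s(i := n)"
    have s_less: "s j < N2" for j using N2 by auto
    then have s_le: "s j \<le> N2" for j using less_imp_le by blast
    have s': "crec s'" "s' j \<le> n" for j
      using set_env_upd[OF s, of i n] s_le[of j] unfolding s'_def set_env_def n_def
      by (auto simp: le_max_iff_disj)
    \<comment> \<open>The format of \<open>nums\<close> and \<open>sets\<close>: numbers come from
      \<open>e\<close>, and set variable \<open>j\<close> is row \<open>s' j\<close> of
      \<open>F\<close>, so variable \<open>i\<close> denotes the fresh row.\<close>
    define code_asg where "code_asg F j =
      (if even j then e (j div 2) else F (pair (s' (p1 (j div 2))) (p2 (j div 2))))" for F :: "nat \<Rightarrow> nat" and j
    have asg: "nums (code_asg F) = e" "sets (code_asg F) = (\<lambda>j. row F (s j))(i := row F n)" for F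
      by (auto simp: nums_def sets_def code_asg_def row_def s'_def fun_eq_iff)
    obtain P where P: "cdec P" "\<And>G. sat UNIV (nums G) (sets G) \<theta> \<longleftrightarrow> (\<exists>w. \<forall>k. P (\<lambda>n. pair (w n) (G n)) k)"
      using Sig_arithmetical(1)[OF assms(1), of UNIV] unfolding Sig_def by blast
    define K where "K = {F. \<forall>k. P (\<lambda>j. pair (F (pair (Suc n) j)) (code_asg F j)) k}"
    have "effclosed K"
      unfolding K_def code_asg_def using e s'
      by (intro effclosed_all cdec_subst[OF P(1)] ceff_intros ceff_op1[of e] ceff_op1[of s'])
        (auto simp: num_env_def)
    have "supported (n + 2) K"
      unfolding supported_def
    proof (intro allI impI)
      fix F F' assume "F \<in> K" and eq: "\<forall>i<n + 2. \<forall>m. F (pair i m) = F' (pair i m)"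
      have "code_asg F = code_asg F'"
        using eq s'(2) by (auto simp: code_asg_def fun_eq_iff le_imp_less_Suc less_SucI)
      moreover have "F (pair (Suc n) j) = F' (pair (Suc n) j)" for j using eq by simp
      ultimately show "F' \<in> K" using \<open>F \<in> K\<close> by (simp add: K_def)
    qed
    define F1 where "F1 z = (if p1 z = n then if p2 z \<in> Y then 1 else 0 else F z)" for z
    have "(\<lambda>j. row F1 (s j))(i := row F1 n) = (\<lambda>j. row F (s j))(i := Y)"
    proof
      fix j
      have "s j \<noteq> n" using s_less[of j] by (auto simp: n_def)
      then show "((\<lambda>j. row F1 (s j))(i := row F1 n)) j = ((\<lambda>j. row F (s j))(i := Y)) j"
        by (auto simp: F1_def row_def)
    qed
    then have "sat UNIV (nums (code_asg F1)) (sets (code_asg F1)) \<theta>" using Y by (simp add: asg)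
    then obtain w where w: "\<forall>k. P (\<lambda>j. pair (w j) (code_asg F1 j)) k" using P(2) by blast
    \<comment> \<open>\<open>s'\<close> never points at row \<open>Suc n\<close>, so storing
      \<open>w\<close> there leaves the coded assignment unchanged.\<close>
    define F2 where "F2 z = (if p1 z = Suc n then w (p2 z) else F1 z)" for z
    have "code_asg F2 = code_asg F1"
      using s'(2) by (auto simp: code_asg_def F2_def fun_eq_iff) (metis not_less_eq_eq order_refl)
    then have "F2 \<in> K" using w by (simp add: K_def F2_def)
    moreover have "F2 \<in> p"
    proof -
      have "\<forall>i<N1. \<forall>m. F (pair i m) = F2 (pair i m)" by (auto simp: F2_def F1_def n_def)
      then show ?thesis using N1 F unfolding supported_def by blast
    qed
    ultimately have "cond (p \<inter> K)"
      using cond_IntI p \<open>effclosed K\<close> \<open>supported (n + 2) K\<close> by blast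
    moreover have "sat UNIV e ((\<lambda>j. row F (s j))(i := row F n)) \<theta>" if "F \<in> K" for F
      using that P(2)[of "code_asg F"] by (auto simp: K_def asg)
    then have "p \<inter> K \<in> witnesses e s i \<theta>" unfolding witnesses_def by blast
    ultimately show ?thesis by blast
  qed
qed

section \<open>Splitting conditions and definable rows\<close>

definition splits :: "fm \<Rightarrow> nat \<Rightarrow> (nat \<Rightarrow> nat) set \<Rightarrow> bool" where
  "splits \<phi> i p \<longleftrightarrow> (\<exists>j. forces p (\<lambda>_. 0) (\<lambda>_. j) \<phi> \<and> (\<forall>F\<in>p. row F i \<noteq> row F j))"

text \<open>Dense by its form alone. For a definable row, uniqueness will refute the first
  alternative, leaving a condition with no splitting extension.\<close>

definition settles_split :: "fm \<Rightarrow> nat \<Rightarrow> (nat \<Rightarrow> nat) set set" where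
  "settles_split \<phi> i = {p. splits \<phi> i p \<or> (\<forall>q. cond q \<longrightarrow> q \<subseteq> p \<longrightarrow> \<not> splits \<phi> i q)}"

lemma dense_settles_split: "dense (settles_split \<phi> i)"
  unfolding dense_def settles_split_def by auto

lemma splits_if_row_not_constant:
  assumes p: "cond p" "forces p (\<lambda>_. 0) (\<lambda>_. i) \<phi>"
    and F: "F \<in> p" "F' \<in> p" "row F i \<noteq> row F' i"
  shows "\<exists>q. cond q \<and> q \<subseteq> p \<and> splits \<phi> i q"
proof -
  obtain N0 where "supported N0 p" using p unfolding cond_def by blast
  define N where "N = max N0 (Suc i)"
  have N: "supported N p" "i < N"
    using supported_mono[OF \<open>supported N0 p\<close>, of N] by (auto simp: N_def)
  \<comment> \<open>Swaps the block of rows below \<open>N\<close> with the next block of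
    \<open>N\<close> rows, so \<open>p\<close> and its image constrain disjoint rows.\<close>
  define \<pi> where "\<pi> k = (if k < N then k + N else if k < 2 * N then k - N else k)" for k
  have "crec \<pi>" unfolding \<pi>_def by (intro orec_intros)
  have inv: "\<pi> (\<pi> k) = k" for k by (auto simp: \<pi>_def)
  \<comment> \<open>Inequality of two rows is merely an open condition; fixing one place
    \<open>m\<close> of disagreement makes it closed, as in \<open>K\<close>.\<close>
  obtain m where m: "m \<in> row F i \<longleftrightarrow> m \<notin> row F' i" using F(3) by blast
  define K where "K = {H. \<forall>k::nat. (H (pair i m) = (0::nat) \<and> \<not> H (pair (i + N) m) = 0) \<or>
    (\<not> H (pair i m) = 0 \<and> H (pair (i + N) m) = 0)}"
  have "effclosed K" unfolding K_def by (intro effclosed_all ceff_intros)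
  have "supported (i + N + 1) K" by (auto simp: supported_def K_def)
  obtain N' where N': "supported N' (act \<pi> p)"
    using supported_act[OF \<open>crec \<pi>\<close> inv N(1)] by blast
  \<comment> \<open>The rows of \<open>F\<close> come first and those of \<open>F'\<close> are
    shifted up by \<open>N\<close>: the first block meets \<open>p\<close>, the second its
    copy.\<close>
  define H where "H z = (if p1 z < N then F z else F' (pair (p1 z - N) (p2 z)))" for z
  have "H \<in> p"
  proof -
    have "\<forall>k<N. \<forall>m. F (pair k m) = H (pair k m)" by (simp add: H_def)
    then show ?thesis using N(1) F(1) unfolding supported_def by blast
  qed
  moreover have "H \<in> act \<pi> p"
  proof -
    have "\<forall>k<N. \<forall>m. F' (pair k m) = (H \<circ> permute \<pi>) (pair k m)"
      by (simp add: H_def permute_def \<pi>_def)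
    then have "H \<circ> permute \<pi> \<in> p" using N(1) F(2) unfolding supported_def by blast
    then show ?thesis by (simp add: act_def)
  qed
  moreover have "H \<in> K" using m N(2) by (auto simp: K_def H_def row_def)
  ultimately have "cond (p \<inter> act \<pi> p \<inter> K)"
    using effclosed_act[OF \<open>crec \<pi>\<close> inv] p(1) N' \<open>effclosed K\<close> \<open>supported (i + N + 1) K\<close>
    by (metis IntI cond_IntI cond_def)
  moreover have "forces (p \<inter> act \<pi> p \<inter> K) (\<lambda>_. 0) (\<lambda>_. i + N) \<phi>"
  proof -
    have "\<pi> \<circ> (\<lambda>_. i) = (\<lambda>_::nat. i + N)" using N(2) by (simp add: \<pi>_def fun_eq_iff)
    then have "forces (act \<pi> p) (\<lambda>_. 0) (\<lambda>_. i + N) \<phi>"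
      using forces_act[OF \<open>crec \<pi>\<close> inv p(2)] by simp
    then show ?thesis by (rule forces_mono) blast
  qed
  moreover have "row G i \<noteq> row G (i + N)" if "G \<in> K" for G
    using that unfolding K_def row_def by blast
  ultimately show ?thesis unfolding splits_def by blast
qed

theorem theorem1p1:
  shows "\<exists>M :: nat set set. countable M \<and> beta_model M \<and>
    (\<forall>X\<in>M. definable_in M X \<longrightarrow> X \<in> HYP)"
proof -
  define \<D> where "\<D> = range decides
    \<union> (\<lambda>(e, s, \<phi>). settles e s \<phi>) ` (num_env \<times> set_env \<times> UNIV)
    \<union> (\<lambda>(e, s, i, \<theta>). witnesses e s i \<theta>) ` (num_env \<times> set_env \<times> UNIV \<times> Collect arithmetical)
    \<union> range (\<lambda>(\<phi>, i). settles_split \<phi> i)"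
  have countable: "countable \<D>"
    unfolding \<D>_def using countable_env
    by (intro countable_Un countable_image countable_SIGMA) auto
  have dense: "dense D" if "D \<in> \<D>" for D
    using that dense_decides dense_settles dense_witnesses dense_settles_split unfolding \<D>_def by auto
  obtain P where P: "\<And>n::nat. cond (P n)" "\<And>m n. m \<le> n \<Longrightarrow> P n \<subseteq> P m"
    and meets: "\<And>D. D \<in> \<D> \<Longrightarrow> \<exists>n. P n \<in> D"
    by (rule generic_sequence[OF countable]) (erule dense, rule that)
  have decides: "\<exists>n. P n \<in> decides c" for c by (rule meets) (simp add: \<D>_def)
  have settles: "\<exists>n. P n \<in> settles e s \<phi>" if "e \<in> num_env" "s \<in> set_env" for e s \<phi>
    by (rule meets) (use that in \<open>force simp: \<D>_def\<close>)
  have witnesses: "\<exists>n. P n \<in> witnesses e s i \<theta>"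
    if "e \<in> num_env" "s \<in> set_env" "arithmetical \<theta>" for e s i \<theta>
    by (rule meets) (use that in \<open>force simp: \<D>_def\<close>)
  have settles_split: "\<exists>n. P n \<in> settles_split \<phi> i" for \<phi> i
    by (rule meets) (force simp: \<D>_def)
  obtain g where g: "\<And>n. g \<in> P n" using generic_point[OF P decides] by blast
  define M where "M = range (row g)"
  have truth: "sat M e (\<lambda>j. row g (s j)) \<phi> \<longleftrightarrow> (\<exists>n. forces (P n) e s \<phi>)"
    if "e \<in> num_env" "s \<in> set_env" for e s \<phi>
    unfolding M_def using truth[OF P decides g settles that] .
  have "countable M" by (simp add: M_def)
  moreover have "beta_model M"
    unfolding beta_model_def
  proof (intro allI impI)
    fix \<phi> and e :: "nat \<Rightarrow> nat" and E assume "Sigma11 \<phi>" and E: "\<forall>i\<in>free_set \<phi>. E i \<in> M"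
    then obtain i \<theta> where \<phi>: "\<phi> = ExS i \<theta>" and \<theta>: "arithmetical \<theta>" unfolding Sigma11_def by blast
    have "\<forall>j\<in>free_set \<phi>. \<exists>k. E j = row g k" using E unfolding M_def by blast
    then obtain \<sigma> where \<sigma>: "\<And>j. j \<in> free_set \<phi> \<Longrightarrow> E j = row g (\<sigma> j)"
      using bchoice[of "free_set \<phi>" "\<lambda>j k. E j = row g k"] by blast
    \<comment> \<open>Values outside the free variables are set to 0, which makes both assignments
      recursive and gives \<open>s\<close> a finite range.\<close>
    define s where "s j = (if j \<in> free_set \<phi> then \<sigma> j else 0)" for j
    define e' where "e' j = (if j \<in> free_num \<phi> then e j else 0)" for j
    have "range s \<subseteq> insert 0 (\<sigma> ` free_set \<phi>)" by (auto simp: s_def)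
    then have s: "s \<in> set_env"
      using crec_finite_support[OF finite_free(2)] finite_free(2)[of \<phi>]
      by (auto simp: set_env_def s_def[abs_def] finite_subset)
    have e': "e' \<in> num_env"
      using crec_finite_support[OF finite_free(1)] by (simp add: num_env_def e'_def[abs_def])
    have eq: "sat N e E \<phi> \<longleftrightarrow> sat N e' (\<lambda>j. row g (s j)) \<phi>" for N
      by (rule sat_cong) (simp_all add: e'_def s_def \<sigma>)
    have "sat UNIV e' (\<lambda>j. row g (s j)) \<phi> \<longleftrightarrow> sat M e' (\<lambda>j. row g (s j)) \<phi>"
    proof
      assume "sat UNIV e' (\<lambda>j. row g (s j)) \<phi>"
      \<comment> \<open>The first alternative of \<open>witnesses\<close> fails at \<open>g\<close>
        itself, so the second names a row of \<open>g\<close> as a witness.\<close>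
      then obtain n where "sat UNIV e' ((\<lambda>j. row g (s j))(i := row g n)) \<theta>"
        using witnesses[OF e' s \<theta>, of i] g unfolding witnesses_def \<phi> by blast
      then have "sat M e' ((\<lambda>j. row g (s j))(i := row g n)) \<theta>"
        using sat_arithmetical[OF \<theta>] by blast
      then show "sat M e' (\<lambda>j. row g (s j)) \<phi>"
        unfolding \<phi> M_def by auto
    next
      assume "sat M e' (\<lambda>j. row g (s j)) \<phi>"
      then show "sat UNIV e' (\<lambda>j. row g (s j)) \<phi>"
        using sat_arithmetical[OF \<theta>, of M _ _ UNIV] unfolding \<phi> by auto
    qed
    then show "sat UNIV e E \<phi> \<longleftrightarrow> sat M e E \<phi>" by (simp add: eq)
  qed
  moreover have "X \<in> HYP" if "definable_in M X" for X
  proof -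
    obtain \<phi> where unique: "\<exists>!Y. Y \<in> M \<and> sat M (\<lambda>_. 0) (\<lambda>_. Y) \<phi>"
      and X: "X \<in> M" "sat M (\<lambda>_. 0) (\<lambda>_. X) \<phi>"
      using \<open>definable_in M X\<close> unfolding definable_in_def by blast
    obtain i where i: "X = row g i" using X(1) unfolding M_def by blast
    have truth': "sat M (\<lambda>_. 0) (\<lambda>_. row g j) \<phi> \<longleftrightarrow> (\<exists>n. forces (P n) (\<lambda>_. 0) (\<lambda>_. j) \<phi>)" for j
      using truth[OF const_env] .
    obtain n1 where n1: "forces (P n1) (\<lambda>_. 0) (\<lambda>_. i) \<phi>"
      using X(2) truth' unfolding i by blast
    obtain n2 where n2: "P n2 \<in> settles_split \<phi> i" using settles_split by blast
    \<comment> \<open>\<open>g\<close> lies in \<open>P n2\<close>, so a split would give a second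
      element of \<open>M\<close> satisfying \<open>\<phi>\<close>.\<close>
    have "\<not> splits \<phi> i (P n2)"
    proof
      assume "splits \<phi> i (P n2)"
      then obtain j where "forces (P n2) (\<lambda>_. 0) (\<lambda>_. j) \<phi>" "row g i \<noteq> row g j"
        using g unfolding splits_def by blast
      then show False using unique X truth' unfolding i M_def by blast
    qed
    then have no_split: "cond q \<Longrightarrow> q \<subseteq> P n2 \<Longrightarrow> \<not> splits \<phi> i q" for q
      using n2 unfolding settles_split_def by blast
    \<comment> \<open>A common extension: \<open>P n1\<close> forces \<open>\<phi>\<close> of row
      \<open>i\<close>, and nothing below \<open>P n2\<close> splits.\<close>
    define n where "n = max n1 n2"
    have sub: "P n \<subseteq> P n1" "P n \<subseteq> P n2" unfolding n_def by (simp_all add: P(2))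
    have "row F i = X" if "F \<in> P n" for F
    proof (rule ccontr)
      assume "row F i \<noteq> X"
      then obtain q where "cond q" "q \<subseteq> P n" "splits \<phi> i q"
        using splits_if_row_not_constant[OF P(1) forces_mono[OF n1 sub(1)] \<open>F \<in> P n\<close> g] i by metis
      then show False using no_split sub(2) by blast
    qed
    then show ?thesis using HYP_row[of "P n"] P(1)[of n] unfolding cond_def by blast
  qed
  ultimately show ?thesis by blast
qed

end
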